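(* Let $(X,a,c)$ be a $\rho$-bialgebra and let $(X,a,\widetilde c)$ be a lax $\rho$-bialgebra (same $X$ and $a$). For every congruence $R\rightarrowtail X\times X$ on $(X,a)$ and every ordinal $\alpha$, the relation $\square^{\alpha}R$ (built from $\overline B$, $c$, $\widetilde c$) is a congruence on $(X,a)$.
   Context: Category: $\mathbb{C}$ is complete, has finite coproducts, is well-powered, monomorphisms are stable under finite coproducts, strong epimorphisms are stable under pullback; morphisms have (strong epi, mono)-factorizations (the mono part is the image). A relation on $X$ is a subobject $\langle l_R,r_R\rangle\colon R\rightarrowtail X\times X$; relations on $X$ form a complete lattice ($\le$, top $\top$, meets $\wedge$). $\mathrm{Rel}(\mathbb{C})$: objects relations, morphisms from $R\rightarrowtail X\times X$ to $S\rightarrowtail Y\times Y$ are $f\colon X\to Y$ such that $(f\times f)\circ\langle l_R,r_R\rangle$ factors through $S$; products/coproducts of relations formed as in $\mathbb{C}$. For $f,g\colon X\to Y$: $(f\times g)_\star[R]$ is the image of $(f\times g)\circ\langle l_R,r_R\rangle$, $f_\star=(f\times f)_\star$, and $(f\times g)^\star[S]$ is the pullback of $S\rightarrowtail Y\times Y$ along $f\times g$. $\Delta_X=\langle\mathrm{id},\mathrm{id}\rangle$. Data: an object $V$; a functor $\Sigma=V+\Sigma'$ on $\mathbb{C}$ preserving strong epimorphisms with free algebras $\Sigma^\star X$ (free monad $\Sigma^\star$), $\hat a\colon\Sigma^\star A\to A$ the extension of $\mathrm{id}_A$ for an algebra $(A,a)$; $\nabla=[\mathrm{id},\mathrm{id}]$;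 the canonical lifting $\overline\Sigma R$ = image of $\langle\Sigma l_R,\Sigma r_R\rangle$ (similarly $\overline{\Sigma^\star}$ for $\Sigma^\star$); a congruence on $(A,a)$ is $R$ with $a_\star[\overline\Sigma R]\le R$. A bifunctor $B\colon\mathbb{C}^{op}\times\mathbb{C}\to\mathbb{C}$ with a relation lifting $\overline B\colon\mathrm{Rel}(\mathbb{C})^{op}\times\mathrm{Rel}(\mathbb{C})\to\mathrm{Rel}(\mathbb{C})$ (a functor with $\overline B(R,S)$ a relation on $B(X,Y)$ whenever $R,S$ are relations on $X,Y$, acting as $B$ on morphisms). For each $X,Y$, a preordered object structure on $B(X,Y)$: preorders $\preceq$ on each hom-set $\mathbb{C}(Z,B(X,Y))$ with $f\preceq g\Rightarrow f\circ h\preceq g\circ h$. Each $\overline B(R,S)$ is up-closed: for every span $f,g\colon Z\to B(X,Y)$ and $h\colon Z\to\overline B(R,S)$ with $l\circ h=f$ and $r\circ h\preceq g$ there is $h'\colon Z\to\overline B(R,S)$ with $l\circ h'=f$ and $r\circ h'=g$. A $V$-pointed higher-order GSOS law $\rho_{X,Y}\colon\Sigma(X\times B(X,Y))\to B(X,\Sigma^\star(X+Y))$, dinatural in $(X,p_X\colon V\to X)\in V/\mathbb{C}$ and natural in $Y$; a $\Sigma$-algebra $(A,a)$ is $V$-pointed by $a\circ\mathrm{inl}$. $\rho$ lifts: for every $V$-pointed $X$, relation $R$ on $X$ through which $\langle p_X,p_X\rangle$ factors, and relation $S$ on $Y$, $\rho_{X,Y}$ is a $\mathrm{Rel}(\mathbb{C})$-morphism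 from $\overline\Sigma(R\times\overline B(R,S))$ to $\overline B(R,\overline{\Sigma^\star}(R+S))$. A lax $\rho$-bialgebra $(X,a,c)$: $a\colon\Sigma X\to X$, $c\colon X\to B(X,X)$ with $B(\mathrm{id},\hat a)\circ B(\mathrm{id},\Sigma^\star\nabla)\circ\rho_{X,X}\circ\Sigma\langle\mathrm{id},c\rangle\preceq c\circ a$; a $\rho$-bialgebra if equality holds. Step-indexed henceforth for coalgebras $c,\widetilde c\colon X\to B(X,X)$ and a relation $R$ on $X$: $\square^0R=R$, $\square^{\alpha+1}R=\square^\alpha R\wedge(c\times\widetilde c)^\star[\overline B(\square^\alpha R,\square^\alpha R)]$, $\square^\alpha R=\bigwedge_{\beta<\alpha}\square^\beta R$ for limit $\alpha$. *)

theory Defs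
  imports "HOL-Library.Equipollence"
begin

section \<open>Categories and functors\<close>

record ('o, 'm) cat =
  Obj :: "'o set"
  Arr :: "'m set"
  Dom :: "'m \<Rightarrow> 'o"
  Cod :: "'m \<Rightarrow> 'o"
  Ident :: "'o \<Rightarrow> 'm"
  Comp :: "'m \<Rightarrow> 'm \<Rightarrow> 'm" (infixr "\<cdot>\<index>" 70)

definition hom :: "('o, 'm, 'z) cat_scheme \<Rightarrow> 'o \<Rightarrow> 'o \<Rightarrow> 'm set" where
  "hom C X Y = {f \<in> Arr C. Dom C f = X \<and> Cod C f = Y}"

locale category =
  fixes C :: "('o, 'm, 'z) cat_scheme" (structure)
  assumes dom_obj: "f \<in> Arr C \<Longrightarrow> Dom C f \<in> Obj C"
    and cod_obj: "f \<in> Arr C \<Longrightarrow> Cod C f \<in> Obj C"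
    and ident_hom: "X \<in> Obj C \<Longrightarrow> Ident C X \<in> hom C X X"
    and comp_hom: "\<lbrakk>f \<in> hom C X Y; g \<in> hom C Y Z\<rbrakk> \<Longrightarrow> g \<cdot> f \<in> hom C X Z"
    and comp_assoc: "\<lbrakk>f \<in> hom C W X; g \<in> hom C X Y; h \<in> hom C Y Z\<rbrakk>
          \<Longrightarrow> h \<cdot> (g \<cdot> f) = (h \<cdot> g) \<cdot> f"
    and comp_ident_right: "f \<in> hom C X Y \<Longrightarrow> f \<cdot> Ident C X = f"
    and comp_ident_left: "f \<in> hom C X Y \<Longrightarrow> Ident C Y \<cdot> f = f"

definition op_cat :: "('o, 'm) cat \<Rightarrow> ('o, 'm) cat" where
  "op_cat C = \<lparr>Obj = Obj C, Arr = Arr C, Dom = Cod C, Cod = Dom C, Ident = Ident C,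
     Comp = (\<lambda>g f. f \<cdot>\<^bsub>C\<^esub> g)\<rparr>"

definition prod_cat :: "('o1, 'm1) cat \<Rightarrow> ('o2, 'm2) cat \<Rightarrow> ('o1 \<times> 'o2, 'm1 \<times> 'm2) cat" where
  "prod_cat C D = \<lparr>Obj = Obj C \<times> Obj D, Arr = Arr C \<times> Arr D,
     Dom = map_prod (Dom C) (Dom D), Cod = map_prod (Cod C) (Cod D),
     Ident = map_prod (Ident C) (Ident D),
     Comp = (\<lambda>(g, g') (f, f'). (g \<cdot>\<^bsub>C\<^esub> f, g' \<cdot>\<^bsub>D\<^esub> f'))\<rparr>"

record ('o1, 'm1, 'o2, 'm2) cat_functor =
  FObj :: "'o1 \<Rightarrow> 'o2"
  FArr :: "'m1 \<Rightarrow> 'm2"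

definition is_functor ::
    "('o1, 'm1) cat \<Rightarrow> ('o2, 'm2) cat \<Rightarrow> ('o1, 'm1, 'o2, 'm2) cat_functor \<Rightarrow> bool" where
  "is_functor C D F \<longleftrightarrow>
     (\<forall>X\<in>Obj C. FObj F X \<in> Obj D \<and> FArr F (Ident C X) = Ident D (FObj F X)) \<and>
     (\<forall>X Y. \<forall>f\<in>hom C X Y. FArr F f \<in> hom D (FObj F X) (FObj F Y)) \<and>
     (\<forall>X Y Z. \<forall>f\<in>hom C X Y. \<forall>g\<in>hom C Y Z. FArr F (g \<cdot>\<^bsub>C\<^esub> f) = FArr F g \<cdot>\<^bsub>D\<^esub> FArr F f)"

section \<open>Monomorphisms, strong epimorphisms, images\<close>

definition mono_arr :: "('o, 'm) cat \<Rightarrow> 'm \<Rightarrow> bool" where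
  "mono_arr C m \<longleftrightarrow> m \<in> Arr C \<and>
     (\<forall>Z. \<forall>f\<in>hom C Z (Dom C m). \<forall>g\<in>hom C Z (Dom C m). m \<cdot>\<^bsub>C\<^esub> f = m \<cdot>\<^bsub>C\<^esub> g \<longrightarrow> f = g)"

definition epi_arr :: "('o, 'm) cat \<Rightarrow> 'm \<Rightarrow> bool" where
  "epi_arr C e = mono_arr (op_cat C) e"

definition strong_epi :: "('o, 'm) cat \<Rightarrow> 'm \<Rightarrow> bool" where
  "strong_epi C e \<longleftrightarrow> epi_arr C e \<and>
     (\<forall>m u v. mono_arr C m \<longrightarrow> u \<in> hom C (Dom C e) (Dom C m) \<longrightarrow> v \<in> hom C (Cod C e) (Cod C m) \<longrightarrow>
        m \<cdot>\<^bsub>C\<^esub> u = v \<cdot>\<^bsub>C\<^esub> e \<longrightarrow>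
        (\<exists>d\<in>hom C (Cod C e) (Dom C m). d \<cdot>\<^bsub>C\<^esub> e = u \<and> m \<cdot>\<^bsub>C\<^esub> d = v))"

definition factors_through :: "('o, 'm) cat \<Rightarrow> 'm \<Rightarrow> 'm \<Rightarrow> bool" where
  "factors_through C f m \<longleftrightarrow> (\<exists>h\<in>hom C (Dom C f) (Dom C m). m \<cdot>\<^bsub>C\<^esub> h = f)"

definition is_image :: "('o, 'm) cat \<Rightarrow> 'm \<Rightarrow> 'm \<Rightarrow> bool" where
  "is_image C f m \<longleftrightarrow> mono_arr C m \<and> Cod C m = Cod C f \<and>
     (\<exists>e\<in>hom C (Dom C f) (Dom C m). strong_epi C e \<and> m \<cdot>\<^bsub>C\<^esub> e = f)"

text \<open>Objects with a universal property (images, products, pullbacks, free algebras, meets) are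
  unique up to isomorphism; a representative is fixed by choice.\<close>

definition image_arr :: "('o, 'm) cat \<Rightarrow> 'm \<Rightarrow> 'm" where
  "image_arr C f = (SOME m. is_image C f m)"

section \<open>Limits and finite coproducts\<close>

definition is_product :: "('o, 'm) cat \<Rightarrow> 'o \<Rightarrow> 'o \<Rightarrow> 'm \<Rightarrow> 'm \<Rightarrow> bool" where
  "is_product C X Y p q \<longleftrightarrow> p \<in> hom C (Dom C p) X \<and> q \<in> hom C (Dom C p) Y \<and>
     (\<forall>Z. \<forall>f\<in>hom C Z X. \<forall>g\<in>hom C Z Y.
        \<exists>!h. h \<in> hom C Z (Dom C p) \<and> p \<cdot>\<^bsub>C\<^esub> h = f \<and> q \<cdot>\<^bsub>C\<^esub> h = g)"

definition chosen_product :: "('o, 'm) cat \<Rightarrow> 'o \<Rightarrow> 'o \<Rightarrow> 'm \<times> 'm" where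
  "chosen_product C X Y = (SOME pq. is_product C X Y (fst pq) (snd pq))"

definition pr1 :: "('o, 'm) cat \<Rightarrow> 'o \<Rightarrow> 'o \<Rightarrow> 'm" where
  "pr1 C X Y = fst (chosen_product C X Y)"

definition pr2 :: "('o, 'm) cat \<Rightarrow> 'o \<Rightarrow> 'o \<Rightarrow> 'm" where
  "pr2 C X Y = snd (chosen_product C X Y)"

definition prod_obj :: "('o, 'm) cat \<Rightarrow> 'o \<Rightarrow> 'o \<Rightarrow> 'o" where
  "prod_obj C X Y = Dom C (pr1 C X Y)"

definition pairing :: "('o, 'm) cat \<Rightarrow> 'm \<Rightarrow> 'm \<Rightarrow> 'm" where
  "pairing C f g = (THE h. h \<in> hom C (Dom C f) (prod_obj C (Cod C f) (Cod C g)) \<and>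
     pr1 C (Cod C f) (Cod C g) \<cdot>\<^bsub>C\<^esub> h = f \<and> pr2 C (Cod C f) (Cod C g) \<cdot>\<^bsub>C\<^esub> h = g)"

definition prod_arr :: "('o, 'm) cat \<Rightarrow> 'm \<Rightarrow> 'm \<Rightarrow> 'm" where
  "prod_arr C f g =
     pairing C (f \<cdot>\<^bsub>C\<^esub> pr1 C (Dom C f) (Dom C g)) (g \<cdot>\<^bsub>C\<^esub> pr2 C (Dom C f) (Dom C g))"

definition inj1 :: "('o, 'm) cat \<Rightarrow> 'o \<Rightarrow> 'o \<Rightarrow> 'm" where
  "inj1 C = pr1 (op_cat C)"

definition inj2 :: "('o, 'm) cat \<Rightarrow> 'o \<Rightarrow> 'o \<Rightarrow> 'm" where
  "inj2 C = pr2 (op_cat C)"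

definition coprod_obj :: "('o, 'm) cat \<Rightarrow> 'o \<Rightarrow> 'o \<Rightarrow> 'o" where
  "coprod_obj C = prod_obj (op_cat C)"

definition copairing :: "('o, 'm) cat \<Rightarrow> 'm \<Rightarrow> 'm \<Rightarrow> 'm" where
  "copairing C = pairing (op_cat C)"

definition coprod_arr :: "('o, 'm) cat \<Rightarrow> 'm \<Rightarrow> 'm \<Rightarrow> 'm" where
  "coprod_arr C = prod_arr (op_cat C)"

definition codiagonal :: "('o, 'm) cat \<Rightarrow> 'o \<Rightarrow> 'm" where
  "codiagonal C X = copairing C (Ident C X) (Ident C X)"

definition has_finite_coproducts :: "('o, 'm) cat \<Rightarrow> bool" where
  "has_finite_coproducts C \<longleftrightarrow>
     (\<exists>I\<in>Obj C. \<forall>X\<in>Obj C. \<exists>!f. f \<in> hom C I X) \<and>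
     (\<forall>X\<in>Obj C. \<forall>Y\<in>Obj C. \<exists>i j. is_product (op_cat C) X Y i j)"

definition is_pullback :: "('o, 'm) cat \<Rightarrow> 'm \<Rightarrow> 'm \<Rightarrow> 'm \<Rightarrow> 'm \<Rightarrow> bool" where
  "is_pullback C f g p q \<longleftrightarrow>
     p \<in> hom C (Dom C p) (Dom C f) \<and> q \<in> hom C (Dom C p) (Dom C g) \<and> f \<cdot>\<^bsub>C\<^esub> p = g \<cdot>\<^bsub>C\<^esub> q \<and>
     (\<forall>Z. \<forall>u\<in>hom C Z (Dom C f). \<forall>v\<in>hom C Z (Dom C g). f \<cdot>\<^bsub>C\<^esub> u = g \<cdot>\<^bsub>C\<^esub> v \<longrightarrow>
        (\<exists>!h. h \<in> hom C Z (Dom C p) \<and> p \<cdot>\<^bsub>C\<^esub> h = u \<and> q \<cdot>\<^bsub>C\<^esub> h = v))"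

text \<open>Pullback of \<open>m\<close> along \<open>f\<close>, as an arrow into the domain of \<open>f\<close>.\<close>

definition pullback_along :: "('o, 'm) cat \<Rightarrow> 'm \<Rightarrow> 'm \<Rightarrow> 'm" where
  "pullback_along C f m = (SOME p. \<exists>q. is_pullback C f m p q)"

definition is_cone ::
    "('o, 'm) cat \<Rightarrow> ('j, 'k) cat \<Rightarrow> ('j, 'k, 'o, 'm) cat_functor \<Rightarrow> 'o \<Rightarrow> ('j \<Rightarrow> 'm) \<Rightarrow> bool" where
  "is_cone C J D L p \<longleftrightarrow> L \<in> Obj C \<and> (\<forall>j\<in>Obj J. p j \<in> hom C L (FObj D j)) \<and>
     (\<forall>u\<in>Arr J. FArr D u \<cdot>\<^bsub>C\<^esub> p (Dom J u) = p (Cod J u))"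

definition is_limit ::
    "('o, 'm) cat \<Rightarrow> ('j, 'k) cat \<Rightarrow> ('j, 'k, 'o, 'm) cat_functor \<Rightarrow> 'o \<Rightarrow> ('j \<Rightarrow> 'm) \<Rightarrow> bool" where
  "is_limit C J D L p \<longleftrightarrow> is_cone C J D L p \<and>
     (\<forall>Z q. is_cone C J D Z q \<longrightarrow> (\<exists>!h. h \<in> hom C Z L \<and> (\<forall>j\<in>Obj J. p j \<cdot>\<^bsub>C\<^esub> h = q j)))"

text \<open>The type \<open>'u\<close> is the universe: a set is small if its cardinality is strictly below that
  of \<open>'u\<close>. Taking \<open>'u\<close> of inaccessible cardinality gives the usual notion of smallness. Every
  shape with fewer than \<open>'u\<close> many arrows is isomorphic to one carried by a subset of \<open>'u\<close>.\<close>

definition small :: "'u itself \<Rightarrow> 'a set \<Rightarrow> bool" where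
  "small _ A \<longleftrightarrow> A \<prec> (UNIV :: 'u set)"

definition complete_cat :: "'u itself \<Rightarrow> ('o, 'm) cat \<Rightarrow> bool" where
  "complete_cat u C \<longleftrightarrow>
     (\<forall>(J :: ('u, 'u) cat) D. category J \<and> small u (Arr J) \<and> is_functor J C D \<longrightarrow>
        (\<exists>L p. is_limit C J D L p))"

definition well_powered :: "'u itself \<Rightarrow> ('o, 'm) cat \<Rightarrow> bool" where
  "well_powered u C \<longleftrightarrow>
     (\<forall>X\<in>Obj C. \<exists>M. small u M \<and> (\<forall>m\<in>M. mono_arr C m \<and> Cod C m = X) \<and>
        (\<forall>n. mono_arr C n \<and> Cod C n = X \<longrightarrow>
           (\<exists>m\<in>M. factors_through C n m \<and> factors_through C m n)))"

definition base_category :: "'u itself \<Rightarrow> ('o, 'm) cat \<Rightarrow> bool" where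
  "base_category u C \<longleftrightarrow>
     category C \<and> complete_cat u C \<and> has_finite_coproducts C \<and> well_powered u C \<and>
     (\<forall>m n. mono_arr C m \<and> mono_arr C n \<longrightarrow> mono_arr C (coprod_arr C m n)) \<and>
     (\<forall>f\<in>Arr C. \<forall>e p q. strong_epi C e \<and> Cod C f = Cod C e \<and> is_pullback C f e p q \<longrightarrow>
        strong_epi C p) \<and>
     (\<forall>f\<in>Arr C. \<exists>m. is_image C f m)"

section \<open>Relations\<close>

text \<open>A subobject of \<open>X \<times> X\<close> is given by a representing monomorphism; relations with the same
  base that are mutually below each other in \<open>rel_le\<close> represent the same subobject.\<close>

record ('o, 'm) relation =
  base :: 'o
  emb :: 'm

definition is_relation :: "('o, 'm) cat \<Rightarrow> 'o \<Rightarrow> ('o, 'm) relation \<Rightarrow> bool" where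
  "is_relation C X R \<longleftrightarrow> X \<in> Obj C \<and> base R = X \<and> mono_arr C (emb R) \<and>
     Cod C (emb R) = prod_obj C X X"

definition lft :: "('o, 'm) cat \<Rightarrow> ('o, 'm) relation \<Rightarrow> 'm" where
  "lft C R = pr1 C (base R) (base R) \<cdot>\<^bsub>C\<^esub> emb R"

definition rgt :: "('o, 'm) cat \<Rightarrow> ('o, 'm) relation \<Rightarrow> 'm" where
  "rgt C R = pr2 C (base R) (base R) \<cdot>\<^bsub>C\<^esub> emb R"

definition rel_le :: "('o, 'm) cat \<Rightarrow> ('o, 'm) relation \<Rightarrow> ('o, 'm) relation \<Rightarrow> bool" where
  "rel_le C R S \<longleftrightarrow> base R = base S \<and> factors_through C (emb R) (emb S)"

definition is_rel_meet ::
    "('o, 'm) cat \<Rightarrow> 'o \<Rightarrow> ('o, 'm) relation set \<Rightarrow> ('o, 'm) relation \<Rightarrow> bool" where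
  "is_rel_meet C X A M \<longleftrightarrow> is_relation C X M \<and> (\<forall>R\<in>A. rel_le C M R) \<and>
     (\<forall>N. is_relation C X N \<and> (\<forall>R\<in>A. rel_le C N R) \<longrightarrow> rel_le C N M)"

definition rel_meet ::
    "('o, 'm) cat \<Rightarrow> 'o \<Rightarrow> ('o, 'm) relation set \<Rightarrow> ('o, 'm) relation" where
  "rel_meet C X A = (SOME M. is_rel_meet C X A M)"

definition rel_hom :: "('o, 'm) cat \<Rightarrow> ('o, 'm) relation \<Rightarrow> ('o, 'm) relation \<Rightarrow> 'm set" where
  "rel_hom C R S = {f \<in> hom C (base R) (base S).
     factors_through C (prod_arr C f f \<cdot>\<^bsub>C\<^esub> emb R) (emb S)}"

definition rel_cat :: "('o, 'm) cat \<Rightarrow>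
    (('o, 'm) relation, ('o, 'm) relation \<times> 'm \<times> ('o, 'm) relation) cat" where
  "rel_cat C = \<lparr>Obj = {R. is_relation C (base R) R},
     Arr = {(R, f, S). is_relation C (base R) R \<and> is_relation C (base S) S \<and> f \<in> rel_hom C R S},
     Dom = (\<lambda>(R, f, S). R), Cod = (\<lambda>(R, f, S). S),
     Ident = (\<lambda>R. (R, Ident C (base R), R)),
     Comp = (\<lambda>(S', g, T) (R, f, S). (R, g \<cdot>\<^bsub>C\<^esub> f, T))\<rparr>"

text \<open>\<open>(f \<times> g)\<^sub>\<star>[R]\<close> and \<open>(f \<times> g)\<^sup>\<star>[S]\<close>, for parallel arrows \<open>f\<close> and \<open>g\<close>.\<close>

definition direct_image :: "('o, 'm) cat \<Rightarrow> 'm \<Rightarrow> 'm \<Rightarrow> ('o, 'm) relation \<Rightarrow> ('o, 'm) relation" where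
  "direct_image C f g R =
     \<lparr>base = Cod C f, emb = image_arr C (prod_arr C f g \<cdot>\<^bsub>C\<^esub> emb R)\<rparr>"

definition inverse_image :: "('o, 'm) cat \<Rightarrow> 'm \<Rightarrow> 'm \<Rightarrow> ('o, 'm) relation \<Rightarrow> ('o, 'm) relation" where
  "inverse_image C f g S = \<lparr>base = Dom C f, emb = pullback_along C (prod_arr C f g) (emb S)\<rparr>"

definition rel_prod ::
    "('o, 'm) cat \<Rightarrow> ('o, 'm) relation \<Rightarrow> ('o, 'm) relation \<Rightarrow> ('o, 'm) relation" where
  "rel_prod C R S = \<lparr>base = prod_obj C (base R) (base S),
     emb = pairing C (prod_arr C (lft C R) (lft C S)) (prod_arr C (rgt C R) (rgt C S))\<rparr>"

text \<open>The arrow \<open>\<langle>l\<^sub>R + l\<^sub>S, r\<^sub>R + r\<^sub>S\<rangle> : R + S \<rightarrow> (X + Y) \<times> (X + Y)\<close> need not be monic in general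
  (it is not in the category of groups, for instance); its image is the coproduct in the category
  of relations, and it represents \<open>R + S\<close> itself whenever the arrow is monic.\<close>

definition rel_coprod ::
    "('o, 'm) cat \<Rightarrow> ('o, 'm) relation \<Rightarrow> ('o, 'm) relation \<Rightarrow> ('o, 'm) relation" where
  "rel_coprod C R S = \<lparr>base = coprod_obj C (base R) (base S),
     emb = image_arr C
       (pairing C (coprod_arr C (lft C R) (lft C S)) (coprod_arr C (rgt C R) (rgt C S)))\<rparr>"

definition canonical_lift ::
    "('o, 'm) cat \<Rightarrow> ('o, 'm, 'o, 'm) cat_functor \<Rightarrow> ('o, 'm) relation \<Rightarrow> ('o, 'm) relation" where
  "canonical_lift C F R = \<lparr>base = FObj F (base R),
     emb = image_arr C (pairing C (FArr F (lft C R)) (FArr F (rgt C R)))\<rparr>"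

section \<open>Algebras\<close>

definition pointed_functor ::
    "('o, 'm) cat \<Rightarrow> 'o \<Rightarrow> ('o, 'm, 'o, 'm) cat_functor \<Rightarrow> ('o, 'm, 'o, 'm) cat_functor" where
  "pointed_functor C V S' = \<lparr>FObj = (\<lambda>X. coprod_obj C V (FObj S' X)),
     FArr = (\<lambda>f. coprod_arr C (Ident C V) (FArr S' f))\<rparr>"

definition preserves_strong_epis :: "('o, 'm) cat \<Rightarrow> ('o, 'm, 'o, 'm) cat_functor \<Rightarrow> bool" where
  "preserves_strong_epis C F \<longleftrightarrow> (\<forall>e. strong_epi C e \<longrightarrow> strong_epi C (FArr F e))"

definition is_algebra :: "('o, 'm) cat \<Rightarrow> ('o, 'm, 'o, 'm) cat_functor \<Rightarrow> 'o \<Rightarrow> 'm \<Rightarrow> bool" where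
  "is_algebra C F A a \<longleftrightarrow> A \<in> Obj C \<and> a \<in> hom C (FObj F A) A"

definition algebra_hom ::
    "('o, 'm) cat \<Rightarrow> ('o, 'm, 'o, 'm) cat_functor \<Rightarrow> 'o \<times> 'm \<Rightarrow> 'o \<times> 'm \<Rightarrow> 'm set" where
  "algebra_hom C F A B =
     {h \<in> hom C (fst A) (fst B). h \<cdot>\<^bsub>C\<^esub> snd A = snd B \<cdot>\<^bsub>C\<^esub> FArr F h}"

text \<open>\<open>(T, t)\<close> with unit \<open>e : X \<rightarrow> T\<close> is a free algebra on \<open>X\<close>.\<close>

definition is_free_algebra ::
    "('o, 'm) cat \<Rightarrow> ('o, 'm, 'o, 'm) cat_functor \<Rightarrow> 'o \<Rightarrow> 'o \<Rightarrow> 'm \<Rightarrow> 'm \<Rightarrow> bool" where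
  "is_free_algebra C F X T t e \<longleftrightarrow> is_algebra C F T t \<and> e \<in> hom C X T \<and>
     (\<forall>A a f. is_algebra C F A a \<and> f \<in> hom C X A \<longrightarrow>
        (\<exists>!h. h \<in> algebra_hom C F (T, t) (A, a) \<and> h \<cdot>\<^bsub>C\<^esub> e = f))"

definition has_free_algebras :: "('o, 'm) cat \<Rightarrow> ('o, 'm, 'o, 'm) cat_functor \<Rightarrow> bool" where
  "has_free_algebras C F \<longleftrightarrow> (\<forall>X\<in>Obj C. \<exists>T t e. is_free_algebra C F X T t e)"

definition free_algebra ::
    "('o, 'm) cat \<Rightarrow> ('o, 'm, 'o, 'm) cat_functor \<Rightarrow> 'o \<Rightarrow> ('o \<times> 'm) \<times> 'm" where
  "free_algebra C F X = (SOME ((T, t), e). is_free_algebra C F X T t e)"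

definition free_unit :: "('o, 'm) cat \<Rightarrow> ('o, 'm, 'o, 'm) cat_functor \<Rightarrow> 'o \<Rightarrow> 'm" where
  "free_unit C F X = snd (free_algebra C F X)"

text \<open>The extension to the free algebra on \<open>X\<close> of an arrow \<open>f\<close> from \<open>X\<close> into an algebra \<open>(A, a)\<close>.\<close>

definition free_ext ::
    "('o, 'm) cat \<Rightarrow> ('o, 'm, 'o, 'm) cat_functor \<Rightarrow> 'o \<Rightarrow> 'o \<times> 'm \<Rightarrow> 'm \<Rightarrow> 'm" where
  "free_ext C F X A f = (THE h. h \<in> algebra_hom C F (fst (free_algebra C F X)) A \<and>
     h \<cdot>\<^bsub>C\<^esub> free_unit C F X = f)"

definition free_monad ::
    "('o, 'm) cat \<Rightarrow> ('o, 'm, 'o, 'm) cat_functor \<Rightarrow> ('o, 'm, 'o, 'm) cat_functor" where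
  "free_monad C F = \<lparr>FObj = (\<lambda>X. fst (fst (free_algebra C F X))),
     FArr = (\<lambda>f. free_ext C F (Dom C f) (fst (free_algebra C F (Cod C f)))
       (free_unit C F (Cod C f) \<cdot>\<^bsub>C\<^esub> f))\<rparr>"

definition algebra_eval ::
    "('o, 'm) cat \<Rightarrow> ('o, 'm, 'o, 'm) cat_functor \<Rightarrow> 'o \<Rightarrow> 'm \<Rightarrow> 'm" where
  "algebra_eval C F A a = free_ext C F A (A, a) (Ident C A)"

definition congruence :: "('o, 'm) cat \<Rightarrow> ('o, 'm, 'o, 'm) cat_functor \<Rightarrow> 'o \<Rightarrow> 'm \<Rightarrow>
    ('o, 'm) relation \<Rightarrow> bool" where
  "congruence C F A a R \<longleftrightarrow> is_relation C A R \<and>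
     rel_le C (direct_image C a a (canonical_lift C F R)) R"

section \<open>Bifunctors and relation liftings\<close>

type_synonym ('o, 'm) bifunctor = "('o \<times> 'o, 'm \<times> 'm, 'o, 'm) cat_functor"

type_synonym ('o, 'm) rel_bifunctor =
  "(('o, 'm) relation, ('o, 'm) relation \<times> 'm \<times> ('o, 'm) relation) bifunctor"

definition is_bifunctor :: "('o, 'm) cat \<Rightarrow> ('o, 'm) bifunctor \<Rightarrow> bool" where
  "is_bifunctor C B \<longleftrightarrow> is_functor (prod_cat (op_cat C) C) C B"

definition is_relation_lifting ::
    "('o, 'm) cat \<Rightarrow> ('o, 'm) bifunctor \<Rightarrow> ('o, 'm) rel_bifunctor \<Rightarrow> bool" where
  "is_relation_lifting C B Bl \<longleftrightarrow> is_bifunctor (rel_cat C) Bl \<and>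
     (\<forall>R\<in>Obj (rel_cat C). \<forall>S\<in>Obj (rel_cat C). base (FObj Bl (R, S)) = FObj B (base R, base S)) \<and>
     (\<forall>\<phi>\<in>Arr (rel_cat C). \<forall>\<psi>\<in>Arr (rel_cat C).
        fst (snd (FArr Bl (\<phi>, \<psi>))) = FArr B (fst (snd \<phi>), fst (snd \<psi>)))"

definition preordered_object :: "('o, 'm) cat \<Rightarrow> 'o \<Rightarrow> ('m \<Rightarrow> 'm \<Rightarrow> bool) \<Rightarrow> bool" where
  "preordered_object C A le \<longleftrightarrow>
     (\<forall>Z. reflp_on (hom C Z A) le \<and> transp_on (hom C Z A) le) \<and>
     (\<forall>W Z. \<forall>f\<in>hom C Z A. \<forall>g\<in>hom C Z A. \<forall>h\<in>hom C W Z. le f g \<longrightarrow> le (f \<cdot>\<^bsub>C\<^esub> h) (g \<cdot>\<^bsub>C\<^esub> h))"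

definition up_closed ::
    "('o, 'm) cat \<Rightarrow> ('m \<Rightarrow> 'm \<Rightarrow> bool) \<Rightarrow> ('o, 'm) relation \<Rightarrow> bool" where
  "up_closed C le Q \<longleftrightarrow>
     (\<forall>Z. \<forall>f\<in>hom C Z (base Q). \<forall>g\<in>hom C Z (base Q). \<forall>h\<in>hom C Z (Dom C (emb Q)).
        lft C Q \<cdot>\<^bsub>C\<^esub> h = f \<and> le (rgt C Q \<cdot>\<^bsub>C\<^esub> h) g \<longrightarrow>
        (\<exists>h'\<in>hom C Z (Dom C (emb Q)). lft C Q \<cdot>\<^bsub>C\<^esub> h' = f \<and> rgt C Q \<cdot>\<^bsub>C\<^esub> h' = g))"

section \<open>Higher-order GSOS laws and bialgebras\<close>

text \<open>A law is a family of arrows \<open>\<rho> p Y\<close> indexed by points \<open>p : V \<rightarrow> X\<close> and objects \<open>Y\<close>; the object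
  \<open>X\<close> is the codomain of \<open>p\<close>.\<close>

definition gsos_law :: "('o, 'm) cat \<Rightarrow> 'o \<Rightarrow> ('o, 'm, 'o, 'm) cat_functor \<Rightarrow> ('o, 'm) bifunctor \<Rightarrow>
    ('m \<Rightarrow> 'o \<Rightarrow> 'm) \<Rightarrow> bool" where
  "gsos_law C V S B \<rho> \<longleftrightarrow>
     (\<forall>X\<in>Obj C. \<forall>p\<in>hom C V X. \<forall>Y\<in>Obj C.
        \<rho> p Y \<in> hom C (FObj S (prod_obj C X (FObj B (X, Y))))
          (FObj B (X, FObj (free_monad C S) (coprod_obj C X Y)))) \<and>
     (\<forall>X\<in>Obj C. \<forall>X'\<in>Obj C. \<forall>p\<in>hom C V X. \<forall>p'\<in>hom C V X'. \<forall>h\<in>hom C X X'. \<forall>Y\<in>Obj C.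
        h \<cdot>\<^bsub>C\<^esub> p = p' \<longrightarrow>
        FArr B (Ident C X, FArr (free_monad C S) (coprod_arr C h (Ident C Y)))
          \<cdot>\<^bsub>C\<^esub> \<rho> p Y
          \<cdot>\<^bsub>C\<^esub> FArr S (prod_arr C (Ident C X) (FArr B (h, Ident C Y)))
        = FArr B (h, Ident C (FObj (free_monad C S) (coprod_obj C X' Y)))
          \<cdot>\<^bsub>C\<^esub> \<rho> p' Y
          \<cdot>\<^bsub>C\<^esub> FArr S (prod_arr C h (Ident C (FObj B (X', Y))))) \<and>
     (\<forall>X\<in>Obj C. \<forall>p\<in>hom C V X. \<forall>Y\<in>Obj C. \<forall>Y'\<in>Obj C. \<forall>g\<in>hom C Y Y'.
        \<rho> p Y' \<cdot>\<^bsub>C\<^esub> FArr S (prod_arr C (Ident C X) (FArr B (Ident C X, g)))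
        = FArr B (Ident C X, FArr (free_monad C S) (coprod_arr C (Ident C X) g)) \<cdot>\<^bsub>C\<^esub> \<rho> p Y)"

definition gsos_law_lifts :: "('o, 'm) cat \<Rightarrow> 'o \<Rightarrow> ('o, 'm, 'o, 'm) cat_functor \<Rightarrow>
    ('o, 'm) rel_bifunctor \<Rightarrow> ('m \<Rightarrow> 'o \<Rightarrow> 'm) \<Rightarrow> bool" where
  "gsos_law_lifts C V S Bl \<rho> \<longleftrightarrow>
     (\<forall>X\<in>Obj C. \<forall>p\<in>hom C V X. \<forall>Y\<in>Obj C. \<forall>R Q.
        is_relation C X R \<and> factors_through C (pairing C p p) (emb R) \<and> is_relation C Y Q \<longrightarrow>
        \<rho> p Y \<in> rel_hom C (canonical_lift C S (rel_prod C R (FObj Bl (R, Q))))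
          (FObj Bl (R, canonical_lift C (free_monad C S) (rel_coprod C R Q))))"

definition algebra_point ::
    "('o, 'm) cat \<Rightarrow> 'o \<Rightarrow> ('o, 'm, 'o, 'm) cat_functor \<Rightarrow> 'o \<Rightarrow> 'm \<Rightarrow> 'm" where
  "algebra_point C V S' A a = a \<cdot>\<^bsub>C\<^esub> inj1 C V (FObj S' A)"

definition induced_step :: "('o, 'm) cat \<Rightarrow> 'o \<Rightarrow> ('o, 'm, 'o, 'm) cat_functor \<Rightarrow>
    ('o, 'm) bifunctor \<Rightarrow> ('m \<Rightarrow> 'o \<Rightarrow> 'm) \<Rightarrow> 'o \<Rightarrow> 'm \<Rightarrow> 'm \<Rightarrow> 'm" where
  "induced_step C V S' B \<rho> X a c =
     (let S = pointed_functor C V S' in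
      FArr B (Ident C X, algebra_eval C S X a)
        \<cdot>\<^bsub>C\<^esub> FArr B (Ident C X, FArr (free_monad C S) (codiagonal C X))
        \<cdot>\<^bsub>C\<^esub> \<rho> (algebra_point C V S' X a) X
        \<cdot>\<^bsub>C\<^esub> FArr S (pairing C (Ident C X) c))"

definition bialgebra :: "('o, 'm) cat \<Rightarrow> 'o \<Rightarrow> ('o, 'm, 'o, 'm) cat_functor \<Rightarrow>
    ('o, 'm) bifunctor \<Rightarrow> ('m \<Rightarrow> 'o \<Rightarrow> 'm) \<Rightarrow> 'o \<Rightarrow> 'm \<Rightarrow> 'm \<Rightarrow> bool" where
  "bialgebra C V S' B \<rho> X a c \<longleftrightarrow>
     is_algebra C (pointed_functor C V S') X a \<and> c \<in> hom C X (FObj B (X, X)) \<and>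
     induced_step C V S' B \<rho> X a c = c \<cdot>\<^bsub>C\<^esub> a"

text \<open>\<open>le X Y\<close> is the preorder on arrows into \<open>B(X, Y)\<close>.\<close>

definition lax_bialgebra :: "('o, 'm) cat \<Rightarrow> 'o \<Rightarrow> ('o, 'm, 'o, 'm) cat_functor \<Rightarrow>
    ('o, 'm) bifunctor \<Rightarrow> ('o \<Rightarrow> 'o \<Rightarrow> 'm \<Rightarrow> 'm \<Rightarrow> bool) \<Rightarrow> ('m \<Rightarrow> 'o \<Rightarrow> 'm) \<Rightarrow> 'o \<Rightarrow> 'm \<Rightarrow> 'm \<Rightarrow> bool"
  where
  "lax_bialgebra C V S' B le \<rho> X a c \<longleftrightarrow>
     is_algebra C (pointed_functor C V S') X a \<and> c \<in> hom C X (FObj B (X, X)) \<and>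
     le X X (induced_step C V S' B \<rho> X a c) (c \<cdot>\<^bsub>C\<^esub> a)"

section \<open>Step-indexed relations\<close>

text \<open>Ordinals are the elements of an arbitrary well-ordered type, each standing for the order
  type of its set of predecessors. The branches are zero, successor and limit.\<close>

function transfinite_iterate :: "'a \<Rightarrow> ('a \<Rightarrow> 'a) \<Rightarrow> ('a set \<Rightarrow> 'a) \<Rightarrow> 'i::wellorder \<Rightarrow> 'a" where
  "transfinite_iterate z s l \<alpha> =
     (if \<forall>\<beta>. \<not> \<beta> < \<alpha> then z
      else if \<exists>\<beta><\<alpha>. \<forall>\<gamma><\<alpha>. \<gamma> \<le> \<beta> then s (transfinite_iterate z s l (GREATEST \<beta>. \<beta> < \<alpha>))
      else l (transfinite_iterate z s l ` {\<beta>. \<beta> < \<alpha>}))"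
  by pat_completeness auto
termination
proof (relation "inv_image {(x, y). x < y} (\<lambda>(z, s, l, \<alpha>). \<alpha>)")
  show "wf (inv_image {(x :: 'i::wellorder, y). x < y} (\<lambda>(z :: 'a, s :: 'a \<Rightarrow> 'a, l :: 'a set \<Rightarrow> 'a, \<alpha>). \<alpha>))"
    by (simp add: wf wf_inv_image)
next
  fix z :: 'a and s l and \<alpha> :: "'i::wellorder"
  assume "\<exists>\<beta><\<alpha>. \<forall>\<gamma><\<alpha>. \<gamma> \<le> \<beta>"
  then have "(GREATEST \<beta>. \<beta> < \<alpha>) < \<alpha>"
    by (metis GreatestI2_order)
  then show "((z, s, l, GREATEST \<beta>. \<beta> < \<alpha>), z, s, l, \<alpha>)
      \<in> inv_image {(x, y). x < y} (\<lambda>(z, s, l, \<alpha>). \<alpha>)"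
    by simp
qed simp

declare transfinite_iterate.simps [simp del]

definition step_indexed :: "('o, 'm) cat \<Rightarrow> ('o, 'm) rel_bifunctor \<Rightarrow> 'm \<Rightarrow> 'm \<Rightarrow>
    ('o, 'm) relation \<Rightarrow> 'i::wellorder \<Rightarrow> ('o, 'm) relation" where
  "step_indexed C Bl c c' R =
     transfinite_iterate R
       (\<lambda>Q. rel_meet C (base R) {Q, inverse_image C c c' (FObj Bl (Q, Q))})
       (rel_meet C (base R))"

lemma step_indexed_zero:
  assumes "\<And>\<beta>. \<not> \<beta> < \<alpha>"
  shows "step_indexed C Bl c c' R \<alpha> = R"
  unfolding step_indexed_def by (subst transfinite_iterate.simps) (simp add: assms)

lemma step_indexed_succ:
  assumes "\<beta> < \<alpha>" "\<And>\<gamma>. \<gamma> < \<alpha> \<Longrightarrow> \<gamma> \<le> \<beta>"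
  shows "step_indexed C Bl c c' R \<alpha> = rel_meet C (base R)
    {step_indexed C Bl c c' R \<beta>, inverse_image C c c'
       (FObj Bl (step_indexed C Bl c c' R \<beta>, step_indexed C Bl c c' R \<beta>))}"
proof -
  have "(GREATEST \<beta>. \<beta> < \<alpha>) = \<beta>"
    using assms by (intro Greatest_equality) auto
  then show ?thesis
    unfolding step_indexed_def
    by (subst transfinite_iterate.simps) (use assms in auto)
qed

lemma step_indexed_limit:
  assumes "\<beta>\<^sub>0 < \<alpha>" "\<And>\<beta>. \<beta> < \<alpha> \<Longrightarrow> \<exists>\<gamma><\<alpha>. \<beta> < \<gamma>"
  shows "step_indexed C Bl c c' R \<alpha> =
    rel_meet C (base R) (step_indexed C Bl c c' R ` {\<beta>. \<beta> < \<alpha>})"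
proof -
  have "\<not> (\<exists>\<beta><\<alpha>. \<forall>\<gamma><\<alpha>. \<gamma> \<le> \<beta>)"
    using assms(2) by (meson leD)
  then show ?thesis
    unfolding step_indexed_def
    by (subst transfinite_iterate.simps) (use assms(1) in auto)
qed

end

theory Submission
  imports Defs
begin

text \<open>A relation \<open>R\<close> is a congruence iff the generalized elements of \<open>R\<close> are closed under
  \<open>(f, g) \<mapsto> (a \<cdot> \<Sigma>f, a \<cdot> \<Sigma>g)\<close>, because strong epimorphisms are orthogonal to monomorphisms; hence
  congruences are closed under meets, which gives the limit steps. In a successor step let
  \<open>(l, r)\<close> span \<open>\<box>R\<close>, where \<open>R\<close> is a congruence. Then \<open>(\<langle>l, c \<cdot> l\<rangle>, \<langle>r, c' \<cdot> r\<rangle>)\<close> lies in \<open>R\<close> times the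
  lifting of \<open>B\<close> at \<open>(R, R)\<close>. Since \<open>\<rho>\<close> lifts and evaluation of terms respects the congruence \<open>R\<close>,
  the induced steps for \<open>c\<close> and \<open>c'\<close> send it into the lifting of \<open>B\<close> again. For \<open>c\<close> the result is
  \<open>c \<cdot> a \<cdot> \<Sigma>l\<close>; for \<open>c'\<close> it lies below \<open>c' \<cdot> a \<cdot> \<Sigma>r\<close>, which is reached by up-closure.\<close>

section \<open>Categories with binary products\<close>

text \<open>Products, images, pullbacks, free algebras and meets are representatives fixed by
  choice, and the domain of an image is not known to be any particular object. Generalized elements
  avoid formulas for these representatives: each construction is described once, by the spans that
  factor through it or by the relation morphisms that leave it, and later arguments use only that
  description. Completeness is relative to the universe \<open>'u\<close> and speaks only of shapes
  carried by that type, so a limit is obtained by coding a cospan into \<open>'u\<close>; the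
  infinity of \<open>'u\<close> keeps the coded shapes small. The ordinals come from an arbitrary
  well-order, so the meet in a limit step may run over a family too large to index a diagram;
  well-poweredness replaces it by a small set of representatives. In a successor step the law lifts
  only at relations that contain the point of \<open>X\<close> paired with itself. Every congruence
  for \<Sigma> = V + \<Sigma>' does, because constants take no arguments.\<close>

lemma op_cat_simps [simp]:
  "Obj (op_cat C) = Obj C" "hom (op_cat C) X Y = hom C Y X" "Dom (op_cat C) = Cod C"
  "Cod (op_cat C) = Dom C" "Ident (op_cat C) = Ident C" "Arr (op_cat C) = Arr C"
  "g \<cdot>\<^bsub>op_cat C\<^esub> f = f \<cdot>\<^bsub>C\<^esub> g"
  by (auto simp: op_cat_def hom_def)

lemma hom_ends: "f \<in> hom C X Y \<Longrightarrow> f \<in> Arr C \<and> Dom C f = X \<and> Cod C f = Y"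
  by (simp add: hom_def)

context category
begin

lemma hom_Obj: "f \<in> hom C X Y \<Longrightarrow> X \<in> Obj C" "f \<in> hom C X Y \<Longrightarrow> Y \<in> Obj C"
  using dom_obj cod_obj by (auto simp: hom_def)

end

lemma category_op:
  fixes C :: "('o, 'm) cat"
  assumes "category C"
  shows "category (op_cat C)"
proof -
  interpret category C by fact
  show ?thesis
    by unfold_locales
      (auto simp: dom_obj cod_obj ident_hom comp_hom comp_assoc comp_ident_right comp_ident_left)
qed

text \<open>Only the existence of binary products is assumed, so that the locale applies twice: to
  the base category, where completeness yields products, and to its opposite, where products are the
  coproducts of the base category. Each fact below thus has a dual for coproducts.\<close>

locale product_category = category C for C :: "('o, 'm) cat" (structure) +
  assumes products: "\<lbrakk>X \<in> Obj C; Y \<in> Obj C\<rbrakk> \<Longrightarrow> \<exists>p q. is_product C X Y p q"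
begin

lemma is_product_chosen:
  assumes "X \<in> Obj C" "Y \<in> Obj C"
  shows "is_product C X Y (pr1 C X Y) (pr2 C X Y)"
proof -
  obtain p q where "is_product C X Y (fst (p, q)) (snd (p, q))"
    using products[OF assms] by auto
  then show ?thesis
    unfolding pr1_def pr2_def chosen_product_def by (rule someI)
qed

lemma pr_hom:
  assumes "X \<in> Obj C" "Y \<in> Obj C"
  shows "pr1 C X Y \<in> hom C (prod_obj C X Y) X" "pr2 C X Y \<in> hom C (prod_obj C X Y) Y"
  using is_product_chosen[OF assms] by (auto simp: is_product_def prod_obj_def)

lemma prod_obj_Obj: "X \<in> Obj C \<Longrightarrow> Y \<in> Obj C \<Longrightarrow> prod_obj C X Y \<in> Obj C"
  using pr_hom(1) hom_Obj(1) by blast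

lemma pairing_ex1:
  assumes "f \<in> hom C Z X" "g \<in> hom C Z Y"
  shows "\<exists>!h. h \<in> hom C Z (prod_obj C X Y) \<and> pr1 C X Y \<cdot> h = f \<and> pr2 C X Y \<cdot> h = g"
  using is_product_chosen[of X Y] assms hom_Obj
  unfolding is_product_def prod_obj_def by blast

lemma pairing:
  assumes "f \<in> hom C Z X" "g \<in> hom C Z Y"
  shows "pairing C f g \<in> hom C Z (prod_obj C X Y)"
    and "pr1 C X Y \<cdot> pairing C f g = f" and "pr2 C X Y \<cdot> pairing C f g = g"
proof -
  have "Dom C f = Z" "Cod C f = X" "Cod C g = Y"
    using assms by (auto simp: hom_def)
  then have "pairing C f g =
      (THE h. h \<in> hom C Z (prod_obj C X Y) \<and> pr1 C X Y \<cdot> h = f \<and> pr2 C X Y \<cdot> h = g)"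
    by (simp add: pairing_def)
  then show "pairing C f g \<in> hom C Z (prod_obj C X Y)"
    "pr1 C X Y \<cdot> pairing C f g = f" "pr2 C X Y \<cdot> pairing C f g = g"
    using theI'[OF pairing_ex1[OF assms]] by auto
qed

lemma prod_ext:
  assumes "X \<in> Obj C" "Y \<in> Obj C"
    and "h \<in> hom C Z (prod_obj C X Y)" "h' \<in> hom C Z (prod_obj C X Y)"
    and "pr1 C X Y \<cdot> h = pr1 C X Y \<cdot> h'" "pr2 C X Y \<cdot> h = pr2 C X Y \<cdot> h'"
  shows "h = h'"
proof -
  have "pr1 C X Y \<cdot> h \<in> hom C Z X" "pr2 C X Y \<cdot> h \<in> hom C Z Y"
    using assms(1-3) pr_hom comp_hom by blast+
  from pairing_ex1[OF this] show ?thesis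
    using assms(3-) by metis
qed

lemma prod_arr_eq:
  assumes "f \<in> hom C X X'" "g \<in> hom C Y Y'"
  shows "prod_arr C f g = pairing C (f \<cdot> pr1 C X Y) (g \<cdot> pr2 C X Y)"
  using assms by (simp add: prod_arr_def hom_def)

lemma prod_arr:
  assumes "f \<in> hom C X X'" "g \<in> hom C Y Y'"
  shows "prod_arr C f g \<in> hom C (prod_obj C X Y) (prod_obj C X' Y')"
    and "pr1 C X' Y' \<cdot> prod_arr C f g = f \<cdot> pr1 C X Y"
    and "pr2 C X' Y' \<cdot> prod_arr C f g = g \<cdot> pr2 C X Y"
proof -
  have "f \<cdot> pr1 C X Y \<in> hom C (prod_obj C X Y) X'" "g \<cdot> pr2 C X Y \<in> hom C (prod_obj C X Y) Y'"
    using assms comp_hom hom_Obj pr_hom by metis+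
  from pairing[OF this]
  show "prod_arr C f g \<in> hom C (prod_obj C X Y) (prod_obj C X' Y')"
    "pr1 C X' Y' \<cdot> prod_arr C f g = f \<cdot> pr1 C X Y"
    "pr2 C X' Y' \<cdot> prod_arr C f g = g \<cdot> pr2 C X Y"
    using prod_arr_eq[OF assms] by auto
qed

lemma pr_prod_arr_comp:
  assumes "f \<in> hom C X X'" "g \<in> hom C Y Y'" "w \<in> hom C Z (prod_obj C X Y)"
  shows "pr1 C X' Y' \<cdot> (prod_arr C f g \<cdot> w) = f \<cdot> (pr1 C X Y \<cdot> w)"
    and "pr2 C X' Y' \<cdot> (prod_arr C f g \<cdot> w) = g \<cdot> (pr2 C X Y \<cdot> w)"
proof -
  note objs = assms[THEN hom_Obj(1)] assms[THEN hom_Obj(2)]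
  note pr = pr_hom[OF objs(1,2)] pr_hom[OF objs(4,5)]
  note pa = prod_arr[OF assms(1,2)]
  show "pr1 C X' Y' \<cdot> (prod_arr C f g \<cdot> w) = f \<cdot> (pr1 C X Y \<cdot> w)"
    using comp_assoc[OF assms(3) pa(1) pr(3)] comp_assoc[OF assms(3) pr(1) assms(1)] pa(2)
    by simp
  show "pr2 C X' Y' \<cdot> (prod_arr C f g \<cdot> w) = g \<cdot> (pr2 C X Y \<cdot> w)"
    using comp_assoc[OF assms(3) pa(1) pr(4)] comp_assoc[OF assms(3) pr(2) assms(2)] pa(3)
    by simp
qed

lemma pairing_comp:
  assumes "f \<in> hom C Z X" "g \<in> hom C Z Y" "h \<in> hom C W Z"
  shows "pairing C f g \<cdot> h = pairing C (f \<cdot> h) (g \<cdot> h)"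
proof -
  note objs = hom_Obj(2)[OF assms(1)] hom_Obj(2)[OF assms(2)]
  note c = comp_hom[OF assms(3,1)] comp_hom[OF assms(3,2)]
  note p = pairing[OF assms(1,2)] and q = pairing[OF c]
  show ?thesis
    by (rule prod_ext[OF objs comp_hom[OF assms(3) p(1)] q(1)])
      (simp_all add: comp_assoc[OF assms(3) p(1) pr_hom(1)[OF objs]]
        comp_assoc[OF assms(3) p(1) pr_hom(2)[OF objs]] p(2,3) q(2,3))
qed

lemma prod_arr_pairing:
  assumes "u \<in> hom C X X'" "v \<in> hom C Y Y'" "f \<in> hom C Z X" "g \<in> hom C Z Y"
  shows "prod_arr C u v \<cdot> pairing C f g = pairing C (u \<cdot> f) (v \<cdot> g)"
proof -
  note objs = hom_Obj(2)[OF assms(1)] hom_Obj(2)[OF assms(2)]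
  note p = pairing[OF assms(3,4)]
  note q = pairing[OF comp_hom[OF assms(3,1)] comp_hom[OF assms(4,2)]]
  show ?thesis
    by (rule prod_ext[OF objs comp_hom[OF p(1) prod_arr(1)[OF assms(1,2)]] q(1)])
      (simp_all add: pr_prod_arr_comp[OF assms(1,2) p(1)] p(2,3) q(2,3))
qed

lemma prod_arr_ident:
  assumes "X \<in> Obj C" "Y \<in> Obj C"
  shows "prod_arr C (Ident C X) (Ident C Y) = Ident C (prod_obj C X Y)"
proof -
  note i = ident_hom[OF assms(1)] ident_hom[OF assms(2)]
  note j = ident_hom[OF prod_obj_Obj[OF assms]]
  show ?thesis
    by (rule prod_ext[OF assms prod_arr(1)[OF i] j])
      (simp_all add: prod_arr(2,3)[OF i] comp_ident_left[OF pr_hom(1)[OF assms]]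
        comp_ident_left[OF pr_hom(2)[OF assms]] comp_ident_right[OF pr_hom(1)[OF assms]]
        comp_ident_right[OF pr_hom(2)[OF assms]])
qed

lemma prod_arr_comp:
  assumes "f \<in> hom C X X'" "g \<in> hom C Y Y'" "f' \<in> hom C X' X''" "g' \<in> hom C Y' Y''"
  shows "prod_arr C (f' \<cdot> f) (g' \<cdot> g) = prod_arr C f' g' \<cdot> prod_arr C f g"
proof -
  note objs = hom_Obj(1)[OF assms(1)] hom_Obj(1)[OF assms(2)]
  have "prod_arr C f' g' \<cdot> prod_arr C f g =
      pairing C (f' \<cdot> (f \<cdot> pr1 C X Y)) (g' \<cdot> (g \<cdot> pr2 C X Y))"
    unfolding prod_arr_eq[OF assms(1,2)]
    by (rule prod_arr_pairing[OF assms(3,4)]; rule comp_hom[OF _ assms(1)] comp_hom[OF _ assms(2)];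
        rule pr_hom[OF objs])
  then show ?thesis
    by (simp add: prod_arr_eq[OF comp_hom[OF assms(1,3)] comp_hom[OF assms(2,4)]]
        comp_assoc[OF pr_hom(1)[OF objs] assms(1,3)] comp_assoc[OF pr_hom(2)[OF objs] assms(2,4)])
qed

end

section \<open>Limits of small cospans\<close>

text \<open>Smallness is stated with equipollence, while the fact that two sets strictly below an
  infinite cardinal have a sum below it is available for cardinal orders; this is the
  bridge.\<close>

lemma lesspoll_iff_card_of_ordLess: "A \<prec> B \<longleftrightarrow> (card_of A, card_of B) \<in> ordLess"
proof -
  have "A \<prec> B \<longleftrightarrow> \<not> B \<lesssim> A"
    by (metis card_of_ordLeq card_of_ordLess eqpoll_imp_lepoll eqpoll_sym lepoll_antisym
        lepoll_def lesspoll_def ordLess_imp_ordLeq)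
  also have "\<dots> \<longleftrightarrow> (card_of A, card_of B) \<in> ordLess"
    unfolding lepoll_def by (rule card_of_ordLess)
  finally show ?thesis .
qed

text \<open>The shape of a wide cospan: \<open>(k, False)\<close> is the object \<open>k\<close> together with its identity, and
  \<open>(Some k, True)\<close> is the arrow from \<open>Some k\<close> to the apex \<open>None\<close>.\<close>

definition cospan :: "'k set \<Rightarrow> ('k option \<times> bool) set" where
  "cospan K = insert (None, False) ((Some ` K) \<times> UNIV)"

text \<open>Besides the apex there are two codes for each index, its identity and its arrow to the
  apex, so the size is at most 1 + |K| + |K|. That stays below an infinite cardinal if |K|
  does.\<close>

lemma cospan_lesspoll:
  fixes K :: "'k set"
  assumes "infinite (UNIV :: 'u set)" "K \<prec> (UNIV :: 'u set)"
  shows "cospan K \<prec> (UNIV :: 'u set)"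
proof -
  define g :: "'k option \<times> bool \<Rightarrow> unit + ('k + 'k)" where
    "g = (\<lambda>(x, b). case x of None \<Rightarrow> Inl () | Some k \<Rightarrow> Inr (if b then Inl k else Inr k))"
  have "inj_on g (cospan K)" "g ` cospan K \<subseteq> {()} <+> (K <+> K)"
    by (auto simp: inj_on_def g_def cospan_def split: if_splits)
  then have "cospan K \<lesssim> {()} <+> (K <+> K)"
    by (auto simp: lepoll_def)
  also have "{()} <+> (K <+> K) \<prec> (UNIV :: 'u set)"
    using assms finite_lesspoll_infinite[OF assms(1), of "{()}"]
    by (simp add: lesspoll_iff_card_of_ordLess card_of_Plus_ordLess_infinite)
  finally show ?thesis .
qed

context
  fixes i :: "'k option \<times> bool \<Rightarrow> 'u" and K :: "'k set"
begin

definition cospan_decode :: "'u \<Rightarrow> 'k option \<times> bool" where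
  "cospan_decode = inv_into (cospan K) i"

text \<open>Completeness quantifies over shapes with objects and arrows in \<open>'u\<close>, so the
  cospan is transported along \<open>i\<close>. Objects are coded by their identities. In a
  composable pair one arrow is an identity, so composition returns \<open>f\<close> if
  \<open>g\<close> is the identity of the codomain of \<open>f\<close>, and \<open>g\<close>
  otherwise.\<close>

definition cospan_cat :: "('u, 'u) cat" where
  "cospan_cat = \<lparr>Obj = (\<lambda>x. i (x, False)) ` insert None (Some ` K), Arr = i ` cospan K,
     Dom = (\<lambda>u. i (fst (cospan_decode u), False)),
     Cod = (\<lambda>u. if snd (cospan_decode u) then i (None, False) else u),
     Ident = (\<lambda>u. u),
     Comp = (\<lambda>g f. if g = (if snd (cospan_decode f) then i (None, False) else f) then f else g)\<rparr>"

context
  assumes inj: "inj_on i (cospan K)"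
begin

lemma cospan_decode [simp]:
  "cospan_decode (i (None, False)) = (None, False)"
  "k \<in> K \<Longrightarrow> cospan_decode (i (Some k, b)) = (Some k, b)"
  using inj by (auto simp: cospan_decode_def cospan_def intro!: inv_into_f_f)

lemma cospan_code_eq [simp]:
  "k \<in> K \<Longrightarrow> i (Some k, b) \<noteq> i (None, False)"
  "k \<in> K \<Longrightarrow> i (None, False) \<noteq> i (Some k, b)"
  "k \<in> K \<Longrightarrow> l \<in> K \<Longrightarrow> i (Some k, b) = i (Some l, b') \<longleftrightarrow> k = l \<and> b = b'"
  by (subst inj_on_eq_iff[OF inj]; simp add: cospan_def)+

lemma cospan_hom:
  "f \<in> hom cospan_cat X Y \<longleftrightarrow>
    (f = X \<and> Y = X \<and> X \<in> Obj cospan_cat) \<or>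
    (\<exists>k\<in>K. f = i (Some k, True) \<and> X = i (Some k, False) \<and> Y = i (None, False))"
proof
  assume f: "f \<in> hom cospan_cat X Y"
  then consider "f = i (None, False)" | k b where "k \<in> K" "f = i (Some k, b)"
    by (auto simp: hom_def cospan_cat_def cospan_def)
  then show "(f = X \<and> Y = X \<and> X \<in> Obj cospan_cat) \<or>
    (\<exists>k\<in>K. f = i (Some k, True) \<and> X = i (Some k, False) \<and> Y = i (None, False))"
    using f by cases (auto simp: hom_def cospan_cat_def split: if_splits)
next
  assume "(f = X \<and> Y = X \<and> X \<in> Obj cospan_cat) \<or>
    (\<exists>k\<in>K. f = i (Some k, True) \<and> X = i (Some k, False) \<and> Y = i (None, False))"
  then show "f \<in> hom cospan_cat X Y"
    by (auto simp: hom_def cospan_cat_def cospan_def)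
qed

text \<open>All nonidentity arrows end in the apex and none starts there, so no two of them
  compose.\<close>

lemma cospan_comp:
  assumes "f \<in> hom cospan_cat X Y" "g \<in> hom cospan_cat Y Z"
  shows "(f = X \<and> Y = X \<and> g \<cdot>\<^bsub>cospan_cat\<^esub> f = g) \<or> (g = Y \<and> Z = Y \<and> g \<cdot>\<^bsub>cospan_cat\<^esub> f = f)"
proof -
  have "g \<cdot>\<^bsub>cospan_cat\<^esub> f = (if g = Y then f else g)"
    using assms(1) by (simp add: hom_def cospan_cat_def)
  moreover have "(f = X \<and> Y = X) \<or> (g = Y \<and> Z = Y)"
    using assms by (auto simp: cospan_hom)
  ultimately show ?thesis by auto
qed

lemma cospan_ident [simp]: "Ident cospan_cat X = X"
  by (simp add: cospan_cat_def)

lemma category_cospan: "category cospan_cat"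
proof
  fix f assume "f \<in> Arr cospan_cat"
  then have "f \<in> hom cospan_cat (Dom cospan_cat f) (Cod cospan_cat f)"
    by (simp add: hom_def)
  then show "Dom cospan_cat f \<in> Obj cospan_cat" "Cod cospan_cat f \<in> Obj cospan_cat"
    unfolding cospan_hom by (auto simp: cospan_cat_def)
next
  fix X assume "X \<in> Obj cospan_cat"
  then show "Ident cospan_cat X \<in> hom cospan_cat X X"
    unfolding cospan_hom by simp
next
  fix f g X Y Z assume "f \<in> hom cospan_cat X Y" "g \<in> hom cospan_cat Y Z"
  then show "g \<cdot>\<^bsub>cospan_cat\<^esub> f \<in> hom cospan_cat X Z"
    using cospan_comp[of f X Y g Z] by auto
next
  fix f g h W X Y Z
  assume f: "f \<in> hom cospan_cat W X" and g: "g \<in> hom cospan_cat X Y" and h: "h \<in> hom cospan_cat Y Z"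
  have *: "u \<cdot>\<^bsub>cospan_cat\<^esub> v = (if u = B then v else u)" if "v \<in> hom cospan_cat A B" for u v A B
    using that by (simp add: hom_def cospan_cat_def)
  show "h \<cdot>\<^bsub>cospan_cat\<^esub> (g \<cdot>\<^bsub>cospan_cat\<^esub> f) = (h \<cdot>\<^bsub>cospan_cat\<^esub> g) \<cdot>\<^bsub>cospan_cat\<^esub> f"
    using cospan_comp[OF f g] cospan_comp[OF g h]
  proof (elim disjE conjE)
    assume "f = W" "X = W" "g \<cdot>\<^bsub>cospan_cat\<^esub> f = g" "g = X" "Y = X" "h \<cdot>\<^bsub>cospan_cat\<^esub> g = h"
      "g \<cdot>\<^bsub>cospan_cat\<^esub> f = g"
    then show ?thesis by simp
  qed (use *[OF f] *[OF g] in auto)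
next
  fix f X Y assume f: "f \<in> hom cospan_cat X Y"
  then have "X \<in> Obj cospan_cat" "Y \<in> Obj cospan_cat"
    unfolding cospan_hom by (auto simp: cospan_cat_def)
  then have "X \<in> hom cospan_cat X X" "Y \<in> hom cospan_cat Y Y"
    by (simp_all add: cospan_hom)
  then show "f \<cdot>\<^bsub>cospan_cat\<^esub> Ident cospan_cat X = f" "Ident cospan_cat Y \<cdot>\<^bsub>cospan_cat\<^esub> f = f"
    using cospan_comp[OF _ f] cospan_comp[OF f] by auto
qed

end

end

text \<open>This hides the coded diagram once and for all: pullbacks, products over a terminal
  object and intersections of subobjects are all derived from it. The leg \<open>q\<close> into the
  apex is separate data, so that the statement also makes sense for empty \<open>K\<close>.\<close>

lemma wide_pullback:
  fixes D :: "('o, 'm) cat" and K :: "'k set"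
  assumes "category D" and "infinite (UNIV :: 'u set)" and "complete_cat TYPE('u) D"
    and "small TYPE('u) K" and "Y \<in> Obj D" and f: "\<And>k. k \<in> K \<Longrightarrow> f k \<in> hom D (A k) Y"
  obtains L q p where "q \<in> hom D L Y"
    and "\<And>k. k \<in> K \<Longrightarrow> p k \<in> hom D L (A k)"
    and "\<And>k. k \<in> K \<Longrightarrow> f k \<cdot>\<^bsub>D\<^esub> p k = q"
    and "\<And>Z g h. \<lbrakk>g \<in> hom D Z Y; \<And>k. k \<in> K \<Longrightarrow> h k \<in> hom D Z (A k) \<and> f k \<cdot>\<^bsub>D\<^esub> h k = g\<rbrakk>
      \<Longrightarrow> \<exists>!x. x \<in> hom D Z L \<and> q \<cdot>\<^bsub>D\<^esub> x = g \<and> (\<forall>k\<in>K. p k \<cdot>\<^bsub>D\<^esub> x = h k)"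
proof -
  interpret D: category D by fact
  have less: "cospan K \<prec> (UNIV :: 'u set)"
    using assms(2,4) by (simp add: small_def cospan_lesspoll)
  then obtain i :: "'k option \<times> bool \<Rightarrow> 'u" where i: "inj_on i (cospan K)"
    using lesspoll_imp_lepoll unfolding lepoll_def by blast
  note [simp] = cospan_decode[OF i]
  let ?J = "cospan_cat i K"
  define dec where "dec = cospan_decode i K"
  define FO where "FO u = (case fst (dec u) of None \<Rightarrow> Y | Some k \<Rightarrow> A k)" for u
  \<comment> \<open>An identity has the same code as its object, so \<open>FO\<close> applied to the
    code of an identity gives the object that the functor needs.\<close>
  define F where "F = \<lparr>FObj = FO,
    FArr = \<lambda>u. if snd (dec u) then f (the (fst (dec u))) else Ident D (FO u)\<rparr>"
  have A: "A k \<in> Obj D" if "k \<in> K" for k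
    using D.hom_Obj(1)[OF f[OF that]] .
  have FO [simp]: "FO (i (None, False)) = Y" "k \<in> K \<Longrightarrow> FO (i (Some k, b)) = A k" for k b
    by (simp_all add: FO_def dec_def)
  have FA [simp]: "FArr F (i (None, False)) = Ident D Y"
    "k \<in> K \<Longrightarrow> FArr F (i (Some k, False)) = Ident D (A k)"
    "k \<in> K \<Longrightarrow> FArr F (i (Some k, True)) = f k" for k
    by (simp_all add: F_def dec_def)
  have FObj [simp]: "FObj F = FO" by (simp add: F_def)
  have Obj: "Obj ?J = insert (i (None, False)) ((\<lambda>k. i (Some k, False)) ` K)"
    by (auto simp: cospan_cat_def)
  have obj: "FO X \<in> Obj D \<and> FArr F X = Ident D (FO X)" if "X \<in> Obj ?J" for X
    using that A assms(5) by (auto simp: Obj)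
  have hom: "FArr F u \<in> hom D (FO X) (FO Z)" if "u \<in> hom ?J X Z" for u X Z
    using that obj f D.ident_hom by (auto simp: cospan_hom[OF i])
  have "is_functor ?J D F"
    unfolding is_functor_def
  proof (intro conjI allI ballI)
    fix X W Z u v assume u: "u \<in> hom ?J X W" and v: "v \<in> hom ?J W Z"
    note hu = hom[OF u] and hv = hom[OF v]
    show "FArr F (v \<cdot>\<^bsub>?J\<^esub> u) = FArr F v \<cdot>\<^bsub>D\<^esub> FArr F u"
      using cospan_comp[OF i u v]
    proof (elim disjE conjE)
      assume "u = X" "v \<cdot>\<^bsub>?J\<^esub> u = v" "W = X"
      moreover have "X \<in> Obj ?J" using category.hom_Obj(1)[OF category_cospan[OF i] u] .
      ultimately show ?thesis
        using D.comp_ident_right[OF hv] obj[of X] by simp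
    next
      assume "v = W" "v \<cdot>\<^bsub>?J\<^esub> u = u" "Z = W"
      moreover have "W \<in> Obj ?J" using category.hom_Obj(2)[OF category_cospan[OF i] u] .
      ultimately show ?thesis
        using D.comp_ident_left[OF hu] obj[of W] by simp
    qed
  qed (use obj hom cospan_ident[OF i] in auto)
  moreover have "small TYPE('u) (Arr ?J)"
    using less i by (simp add: small_def cospan_cat_def)
  ultimately obtain L p where lim: "is_limit D ?J F L p"
    using assms(3) category_cospan[OF i] unfolding complete_cat_def by blast
  \<comment> \<open>Decoded, a cone is a leg into \<open>Y\<close> together with compatible legs
    into the \<open>A k\<close>. The equations for identities hold automatically, and the leg into
    \<open>Y\<close> also supplies \<open>Z \<in> Obj D\<close>.\<close>
  have cone: "is_cone D ?J F Z r \<longleftrightarrow> r (i (None, False)) \<in> hom D Z Y \<and>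
      (\<forall>k\<in>K. r (i (Some k, False)) \<in> hom D Z (A k) \<and>
        f k \<cdot>\<^bsub>D\<^esub> r (i (Some k, False)) = r (i (None, False)))" for Z r
  proof -
    have "(\<forall>u\<in>Arr ?J. FArr F u \<cdot>\<^bsub>D\<^esub> r (Dom ?J u) = r (Cod ?J u)) \<longleftrightarrow>
        Ident D Y \<cdot>\<^bsub>D\<^esub> r (i (None, False)) = r (i (None, False)) \<and>
        (\<forall>k\<in>K. Ident D (A k) \<cdot>\<^bsub>D\<^esub> r (i (Some k, False)) = r (i (Some k, False)) \<and>
          f k \<cdot>\<^bsub>D\<^esub> r (i (Some k, False)) = r (i (None, False)))"
      by (auto simp: cospan_cat_def cospan_def UNIV_bool)
    moreover have "(\<forall>j\<in>Obj ?J. r j \<in> hom D Z (FObj F j)) \<longleftrightarrow>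
        r (i (None, False)) \<in> hom D Z Y \<and> (\<forall>k\<in>K. r (i (Some k, False)) \<in> hom D Z (A k))"
      by (auto simp: Obj)
    ultimately show ?thesis
      unfolding is_cone_def using D.comp_ident_left D.hom_Obj(1) by blast
  qed
  show ?thesis
  proof (rule that)
    have "is_cone D ?J F L p"
      using lim by (simp add: is_limit_def)
    then show "p (i (None, False)) \<in> hom D L Y"
      and "\<And>k. k \<in> K \<Longrightarrow> p (i (Some k, False)) \<in> hom D L (A k)"
      and "\<And>k. k \<in> K \<Longrightarrow> f k \<cdot>\<^bsub>D\<^esub> p (i (Some k, False)) = p (i (None, False))"
      by (auto simp: cone)
    fix Z g h
    assume g: "g \<in> hom D Z Y" and h: "\<And>k. k \<in> K \<Longrightarrow> h k \<in> hom D Z (A k) \<and> f k \<cdot>\<^bsub>D\<^esub> h k = g"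
    define r where "r u = (case fst (dec u) of None \<Rightarrow> g | Some k \<Rightarrow> h k)" for u
    have r: "r (i (None, False)) = g" "k \<in> K \<Longrightarrow> r (i (Some k, b)) = h k" for k b
      by (simp_all add: r_def dec_def)
    have "is_cone D ?J F Z r"
      using g h by (simp add: cone r)
    then have "\<exists>!x. x \<in> hom D Z L \<and> (\<forall>j\<in>Obj ?J. p j \<cdot>\<^bsub>D\<^esub> x = r j)"
      using lim by (simp add: is_limit_def)
    moreover have "(\<forall>j\<in>Obj ?J. p j \<cdot>\<^bsub>D\<^esub> x = r j) \<longleftrightarrow>
        p (i (None, False)) \<cdot>\<^bsub>D\<^esub> x = g \<and> (\<forall>k\<in>K. p (i (Some k, False)) \<cdot>\<^bsub>D\<^esub> x = h k)" for x
      by (auto simp: Obj r)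
    ultimately show "\<exists>!x. x \<in> hom D Z L \<and> p (i (None, False)) \<cdot>\<^bsub>D\<^esub> x = g \<and>
        (\<forall>k\<in>K. p (i (Some k, False)) \<cdot>\<^bsub>D\<^esub> x = h k)"
      by simp
  qed
qed

text \<open>It is the limit of the empty diagram. With no objects or arrows there is nothing to
  check about the remaining fields of the shape or about the functor, hence the
  \<open>undefined\<close> entries.\<close>

lemma terminal_object:
  fixes C :: "('o, 'm) cat"
  assumes "infinite (UNIV :: 'u set)" "complete_cat TYPE('u) C"
  obtains T where "T \<in> Obj C" "\<And>X. X \<in> Obj C \<Longrightarrow> \<exists>!f. f \<in> hom C X T"
proof -
  let ?J = "\<lparr>Obj = {}, Arr = {}, Dom = undefined, Cod = undefined, Ident = undefined,
    Comp = undefined\<rparr> :: ('u, 'u) cat"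
  have "category ?J"
    by unfold_locales (auto simp: hom_def)
  moreover have "small TYPE('u) (Arr ?J)"
    using assms(1) by (simp add: small_def finite_lesspoll_infinite)
  moreover have "is_functor ?J C undefined"
    by (simp add: is_functor_def hom_def)
  ultimately obtain L p where "is_limit C ?J undefined L p"
    using assms(2) unfolding complete_cat_def by blast
  then show ?thesis
    by (intro that[of L]) (auto simp: is_limit_def is_cone_def)
qed

section \<open>Pullbacks and binary products from completeness\<close>

locale complete_category = category C for C :: "('o, 'm) cat" (structure) +
  fixes u :: "'u itself"
  assumes infinite_universe: "infinite (UNIV :: 'u set)"
    and complete: "complete_cat TYPE('u) C"
begin

lemma small_finite: "finite A \<Longrightarrow> small TYPE('u) A"
  using infinite_universe by (simp add: small_def finite_lesspoll_infinite)

lemma pullback_exists: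
  assumes f: "f \<in> hom C X Z" and g: "g \<in> hom C Y Z"
  shows "\<exists>p q. is_pullback C f g p q"
proof -
  \<comment> \<open>The ordinary cospan is the wide one indexed by the booleans, with
    \<open>f\<close> at \<open>True\<close> and \<open>g\<close> at \<open>False\<close>.\<close>
  have *: "(if b then f else g) \<in> hom C (if b then X else Y) Z" for b
    using assms by simp
  show ?thesis
  proof (rule wide_pullback[OF category_axioms infinite_universe complete
      small_finite[OF finite_UNIV] hom_Obj(2)[OF f], of "\<lambda>b. if b then f else g", OF *])
    fix L q p
    assume q: "q \<in> hom C L Z" and "\<And>b. b \<in> UNIV \<Longrightarrow> p b \<in> hom C L (if b then X else Y)"
      and "\<And>b. b \<in> UNIV \<Longrightarrow> (if b then f else g) \<cdot> p b = q"
      and univ: "\<And>W w h. \<lbrakk>w \<in> hom C W Z; \<And>b. b \<in> UNIV \<Longrightarrow>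
          h b \<in> hom C W (if b then X else Y) \<and> (if b then f else g) \<cdot> h b = w\<rbrakk>
        \<Longrightarrow> \<exists>!x. x \<in> hom C W L \<and> q \<cdot> x = w \<and> (\<forall>b\<in>UNIV. p b \<cdot> x = h b)"
    from this(2)[of True] this(2)[of False] this(3)[of True] this(3)[of False]
    have pT: "p True \<in> hom C L X" and pF: "p False \<in> hom C L Y"
      and eqT: "f \<cdot> p True = q" and eqF: "g \<cdot> p False = q"
      by simp_all
    have dom: "Dom C f = X" "Dom C g = Y" "Dom C (p True) = L" "Dom C (p False) = L"
      using f g pT pF by (auto simp: hom_def)
    have "is_pullback C f g (p True) (p False)"
      unfolding is_pullback_def dom
    proof (intro conjI allI ballI impI)
      fix W s t assume s: "s \<in> hom C W X" and t: "t \<in> hom C W Y" and "f \<cdot> s = g \<cdot> t"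
      then have "\<exists>!x. x \<in> hom C W L \<and> q \<cdot> x = f \<cdot> s \<and>
          (\<forall>b\<in>UNIV. p b \<cdot> x = (if b then s else t))"
        using comp_hom[OF s f] by (intro univ) auto
      moreover have "(x \<in> hom C W L \<and> q \<cdot> x = f \<cdot> s \<and> (\<forall>b\<in>UNIV. p b \<cdot> x = (if b then s else t))) \<longleftrightarrow>
          (x \<in> hom C W L \<and> p True \<cdot> x = s \<and> p False \<cdot> x = t)" for x
        using comp_assoc[OF _ pT f] eqT by (auto simp: UNIV_bool)
      ultimately show "\<exists>!h. h \<in> hom C W L \<and> p True \<cdot> h = s \<and> p False \<cdot> h = t"
        by simp
    qed (use pT pF eqT eqF in simp_all)
    then show ?thesis by blast
  qed
qed

text \<open>A pullback over the terminal object is a product, since any two arrows into a terminal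
  object agree and the commutation condition on a cone holds by itself.\<close>

sublocale product_category C
proof
  fix X Y assume X: "X \<in> Obj C" and Y: "Y \<in> Obj C"
  obtain T where T: "T \<in> Obj C" "\<And>X. X \<in> Obj C \<Longrightarrow> \<exists>!f. f \<in> hom C X T"
    using terminal_object[OF infinite_universe complete] by blast
  obtain f g where f: "f \<in> hom C X T" and g: "g \<in> hom C Y T"
    using T(2) X Y by metis
  obtain p q where "is_pullback C f g p q"
    using pullback_exists[OF f g] by blast
  moreover have "f \<cdot> s = g \<cdot> t" if "s \<in> hom C W X" "t \<in> hom C W Y" for W s t
    using T(2)[OF hom_Obj(1)[OF that(1)]] comp_hom[OF that(1) f] comp_hom[OF that(2) g] by metis
  ultimately have "is_product C X Y p q"
    using hom_ends[OF f] hom_ends[OF g] by (simp add: is_pullback_def is_product_def)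
  then show "\<exists>p q. is_product C X Y p q" by blast
qed

end

section \<open>Relations and spans\<close>

text \<open>Spans \<open>f, g : Z \<rightarrow> X\<close> that factor through \<open>R\<close> are its generalized elements at stage \<open>Z\<close>.\<close>

definition related :: "('o, 'm) cat \<Rightarrow> ('o, 'm) relation \<Rightarrow> 'm \<Rightarrow> 'm \<Rightarrow> bool" where
  "related C R f g \<longleftrightarrow>
    (\<exists>h\<in>hom C (Dom C f) (Dom C (emb R)). lft C R \<cdot>\<^bsub>C\<^esub> h = f \<and> rgt C R \<cdot>\<^bsub>C\<^esub> h = g)"

locale relation_category = complete_category C u for C :: "('o, 'm) cat" (structure)
    and u :: "'u itself" +
  assumes coproducts: "has_finite_coproducts C"
    and well_powered: "well_powered TYPE('u) C"
    and images: "f \<in> Arr C \<Longrightarrow> \<exists>m. is_image C f m"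
begin

sublocale op: product_category "op_cat C"
proof -
  interpret op: category "op_cat C"
    by (rule category_op) unfold_locales
  show "product_category (op_cat C)"
    by unfold_locales (use coproducts in \<open>simp add: has_finite_coproducts_def\<close>)
qed

lemmas coprod_obj_Obj = op.prod_obj_Obj[folded coprod_obj_def, simplified]
lemmas inj_hom = op.pr_hom[folded coprod_obj_def inj1_def inj2_def, simplified]
lemmas copairing =
  op.pairing[folded coprod_obj_def inj1_def inj2_def copairing_def, simplified]
lemmas copairing_comp =
  op.pairing_comp[folded coprod_obj_def inj1_def inj2_def copairing_def, simplified]
lemmas coprod_arr =
  op.prod_arr[folded coprod_obj_def inj1_def inj2_def coprod_arr_def, simplified]
lemmas copairing_coprod_arr =
  op.prod_arr_pairing[folded coprod_obj_def coprod_arr_def copairing_def, simplified]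
lemmas coprod_arr_ident = op.prod_arr_ident[folded coprod_obj_def coprod_arr_def, simplified]
lemmas coprod_arr_comp = op.prod_arr_comp[folded coprod_obj_def coprod_arr_def, simplified]

lemma relation_hom:
  assumes "is_relation C X R"
  shows "emb R \<in> hom C (Dom C (emb R)) (prod_obj C X X)"
    and "lft C R \<in> hom C (Dom C (emb R)) X" and "rgt C R \<in> hom C (Dom C (emb R)) X"
proof -
  have X: "X \<in> Obj C" and e: "emb R \<in> hom C (Dom C (emb R)) (prod_obj C X X)" and "base R = X"
    using assms by (auto simp: is_relation_def mono_arr_def hom_def)
  then show "lft C R \<in> hom C (Dom C (emb R)) X" "rgt C R \<in> hom C (Dom C (emb R)) X"
    by (auto simp: lft_def rgt_def intro!: comp_hom[OF e] pr_hom)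
  show "emb R \<in> hom C (Dom C (emb R)) (prod_obj C X X)" by fact
qed

lemma relation_base: "is_relation C X R \<Longrightarrow> base R = X" "is_relation C X R \<Longrightarrow> X \<in> Obj C"
  by (auto simp: is_relation_def)

lemma pairing_lft_rgt:
  assumes "is_relation C X R"
  shows "pairing C (lft C R) (rgt C R) = emb R"
proof -
  note X = relation_base(2)[OF assms] and h = relation_hom[OF assms]
  note p = pairing[OF h(2,3)]
  show ?thesis
    by (rule prod_ext[OF X X p(1) h(1)]; unfold p(2,3))
      (simp_all add: lft_def rgt_def relation_base(1)[OF assms])
qed

text \<open>The definitions speak of arrows into X \<times> X factoring through
  \<open>emb R\<close>; the proofs speak of spans. Comparing both projections of
  \<open>emb R \<cdot> h\<close> with those of the pairing translates between the two.\<close>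

lemma factors_through_pairing_iff:
  assumes R: "is_relation C X R" and f: "f \<in> hom C Z X" and g: "g \<in> hom C Z X"
  shows "factors_through C (pairing C f g) (emb R) \<longleftrightarrow> related C R f g"
proof -
  note X = relation_base(2)[OF R] and r = relation_hom[OF R] and p = pairing[OF f g]
  have dom: "Dom C (pairing C f g) = Z" "Dom C f = Z"
    using p(1) f by (auto simp: hom_def)
  have "emb R \<cdot> h = pairing C f g \<longleftrightarrow> lft C R \<cdot> h = f \<and> rgt C R \<cdot> h = g"
    if h: "h \<in> hom C Z (Dom C (emb R))" for h
  proof
    assume "emb R \<cdot> h = pairing C f g"
    then show "lft C R \<cdot> h = f \<and> rgt C R \<cdot> h = g"
      using comp_assoc[OF h r(1) pr_hom(1)[OF X X]] comp_assoc[OF h r(1) pr_hom(2)[OF X X]] p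
      by (simp add: lft_def rgt_def relation_base(1)[OF R])
  next
    assume "lft C R \<cdot> h = f \<and> rgt C R \<cdot> h = g"
    then show "emb R \<cdot> h = pairing C f g"
      using pairing_comp[OF r(2,3) h] by (simp add: pairing_lft_rgt[OF R])
  qed
  then show ?thesis
    unfolding factors_through_def related_def dom by blast
qed

lemma related_comp:
  assumes "is_relation C X R" "related C R f g" "f \<in> hom C Z X" "h \<in> hom C W Z"
  shows "related C R (f \<cdot> h) (g \<cdot> h)"
proof -
  note r = relation_hom[OF assms(1)]
  obtain k where k: "k \<in> hom C Z (Dom C (emb R))" "lft C R \<cdot> k = f" "rgt C R \<cdot> k = g"
    using assms(2) hom_ends[OF assms(3)] by (auto simp: related_def)
  have "k \<cdot> h \<in> hom C W (Dom C (emb R))" "Dom C (f \<cdot> h) = W"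
    using comp_hom[OF assms(4) k(1)] hom_ends[OF comp_hom[OF assms(4,3)]] by auto
  moreover have "lft C R \<cdot> (k \<cdot> h) = f \<cdot> h" "rgt C R \<cdot> (k \<cdot> h) = g \<cdot> h"
    using comp_assoc[OF assms(4) k(1) r(2)] comp_assoc[OF assms(4) k(1) r(3)] k by auto
  ultimately show ?thesis
    by (auto simp: related_def)
qed

lemma related_compI:
  assumes "is_relation C X R" "h \<in> hom C Z (Dom C (emb R))"
  shows "related C R (lft C R \<cdot> h) (rgt C R \<cdot> h)"
proof -
  have "Dom C (lft C R \<cdot> h) = Z"
    using hom_ends[OF comp_hom[OF assms(2) relation_hom(2)[OF assms(1)]]] by simp
  then show ?thesis
    unfolding related_def using assms(2) by auto
qed

lemma relatedE:
  assumes "related C R f g" "f \<in> hom C Z X"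
  obtains h where "h \<in> hom C Z (Dom C (emb R))" "lft C R \<cdot> h = f" "rgt C R \<cdot> h = g"
  using assms hom_ends[OF assms(2)] by (auto simp: related_def)

lemma related_lft_rgt:
  assumes "is_relation C X R"
  shows "related C R (lft C R) (rgt C R)"
proof -
  note r = relation_hom[OF assms]
  show ?thesis
    using related_compI[OF assms ident_hom[OF hom_Obj(1)[OF r(1)]]]
    by (simp add: comp_ident_right[OF r(2)] comp_ident_right[OF r(3)])
qed

lemma rel_le_iff:
  assumes "is_relation C X R" "is_relation C X S"
  shows "rel_le C R S \<longleftrightarrow> related C S (lft C R) (rgt C R)"
  using factors_through_pairing_iff[OF assms(2) relation_hom(2,3)[OF assms(1)]]
    relation_base(1)[OF assms(1)] relation_base(1)[OF assms(2)]
  by (simp add: rel_le_def pairing_lft_rgt[OF assms(1)])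

text \<open>The span of the two projections is the generic element of \<open>R\<close>: every other
  element is a restriction of it along some arrow \<open>w\<close>, so a pair of arrows has to be
  tested there only.\<close>

lemma related_if_lft_rgt:
  assumes "is_relation C X R" "is_relation C Y S" "h \<in> hom C X Y" "k \<in> hom C X Y"
    and "related C S (h \<cdot> lft C R) (k \<cdot> rgt C R)" "related C R f g" "f \<in> hom C Z X"
  shows "related C S (h \<cdot> f) (k \<cdot> g)"
proof -
  note r = relation_hom[OF assms(1)]
  obtain w where w: "w \<in> hom C Z (Dom C (emb R))" "lft C R \<cdot> w = f" "rgt C R \<cdot> w = g"
    using relatedE[OF assms(6,7)] .
  show ?thesis
    using related_comp[OF assms(2,5) comp_hom[OF r(2) assms(3)] w(1)]
      comp_assoc[OF w(1) r(2) assms(3)] comp_assoc[OF w(1) r(3) assms(4)] w(2,3) by simp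
qed

lemma related_mono:
  assumes "is_relation C X R" "is_relation C X S" "rel_le C R S" "related C R f g" "f \<in> hom C Z X"
  shows "related C S f g"
proof -
  note r = relation_hom[OF assms(1)]
  obtain w where w: "w \<in> hom C Z (Dom C (emb R))" "lft C R \<cdot> w = f" "rgt C R \<cdot> w = g"
    using relatedE[OF assms(4,5)] .
  have "related C S (lft C R) (rgt C R)"
    using assms(1-3) rel_le_iff by blast
  from related_comp[OF assms(2) this r(2) w(1)] show ?thesis
    by (simp add: w)
qed

lemma prod_arr_emb:
  assumes "is_relation C X R" "h \<in> hom C X Y" "k \<in> hom C X Y"
  shows "prod_arr C h k \<cdot> emb R = pairing C (h \<cdot> lft C R) (k \<cdot> rgt C R)"
  using prod_arr_pairing[OF assms(2,3) relation_hom(2,3)[OF assms(1)]] pairing_lft_rgt[OF assms(1)]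
  by simp

lemma rel_hom_iff:
  assumes R: "is_relation C X R" and S: "is_relation C Y S" and h: "h \<in> hom C X Y"
  shows "h \<in> rel_hom C R S \<longleftrightarrow> related C S (h \<cdot> lft C R) (h \<cdot> rgt C R)"
  using factors_through_pairing_iff[OF S comp_hom[OF relation_hom(2)[OF R] h]
      comp_hom[OF relation_hom(3)[OF R] h]] h
    relation_base(1)[OF R] relation_base(1)[OF S]
  by (simp add: rel_hom_def prod_arr_emb[OF R h h])

section \<open>Images and the relations defined by them\<close>

lemma is_image_image_arr: "f \<in> Arr C \<Longrightarrow> is_image C f (image_arr C f)"
  unfolding image_arr_def using images by (rule someI_ex)

text \<open>The diagonal fill-in against the strong epimorphism \<open>e\<close> carries a
  factorization of \<open>p \<cdot> w\<close> down to \<open>p \<cdot> m\<close>. The arrow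
  \<open>p\<close> makes the lemma serve two purposes: with \<open>p\<close> a product of arrows it
  tests morphisms of relations on the span before the image is taken, and with \<open>p\<close> an
  identity it compares the image itself with a relation.\<close>

lemma factors_through_image_iff:
  assumes im: "is_image C w m" and p: "p \<in> hom C (Cod C w) Y"
    and n: "mono_arr C n" "Cod C n = Y"
  shows "factors_through C (p \<cdot> m) n \<longleftrightarrow> factors_through C (p \<cdot> w) n"
proof -
  obtain e where e: "e \<in> hom C (Dom C w) (Dom C m)" "strong_epi C e" "m \<cdot> e = w"
    and m: "m \<in> hom C (Dom C m) (Cod C w)"
    using im by (auto simp: is_image_def mono_arr_def hom_def)
  have w: "w \<in> hom C (Dom C w) (Cod C w)"
    using comp_hom[OF e(1) m] e(3) by simp
  have nh: "n \<in> hom C (Dom C n) Y"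
    using n by (simp add: mono_arr_def hom_def)
  have dom: "Dom C (p \<cdot> m) = Dom C m" "Dom C (p \<cdot> w) = Dom C w"
    using hom_ends[OF comp_hom[OF m p]] hom_ends[OF comp_hom[OF w p]] by auto
  have pme: "(p \<cdot> m) \<cdot> e = p \<cdot> w"
    using comp_assoc[OF e(1) m p] e(3) by simp
  show ?thesis
  proof
    assume "factors_through C (p \<cdot> m) n"
    then obtain h where h: "h \<in> hom C (Dom C m) (Dom C n)" "n \<cdot> h = p \<cdot> m"
      by (auto simp: factors_through_def dom)
    then show "factors_through C (p \<cdot> w) n"
      unfolding factors_through_def dom
      using comp_hom[OF e(1) h(1)] comp_assoc[OF e(1) h(1) nh] pme by auto
  next
    assume "factors_through C (p \<cdot> w) n"
    then obtain h where h: "h \<in> hom C (Dom C w) (Dom C n)" "n \<cdot> h = p \<cdot> w"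
      by (auto simp: factors_through_def dom)
    have "Dom C e = Dom C w" "Cod C e = Dom C m"
      using e(1) by (auto simp: hom_def)
    then have "\<exists>d\<in>hom C (Dom C m) (Dom C n). d \<cdot> e = h \<and> n \<cdot> d = p \<cdot> m"
      using e(2) n h pme comp_hom[OF m p] unfolding strong_epi_def by metis
    then show "factors_through C (p \<cdot> m) n"
      unfolding factors_through_def dom by blast
  qed
qed

text \<open>Canonical lifts and coproducts of relations are images of pairings, chosen by
  \<open>SOME\<close>, so their projections have no explicit form. The second clause makes up for
  this: a morphism out of the image relation is checked on the span that it came from.\<close>

lemma image_relation:
  assumes f: "f \<in> hom C Z X" and g: "g \<in> hom C Z X" and I: "base I = X"
    "emb I = image_arr C (pairing C f g)"
  shows "is_relation C X I"
    and "\<And>h Y S. \<lbrakk>h \<in> hom C X Y; is_relation C Y S\<rbrakk>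
      \<Longrightarrow> h \<in> rel_hom C I S \<longleftrightarrow> related C S (h \<cdot> f) (h \<cdot> g)"
    and "related C I f g"
proof -
  note X = hom_Obj(2)[OF f] and p = pairing[OF f g]
  have im: "is_image C (pairing C f g) (emb I)"
    using is_image_image_arr p(1) by (simp add: I hom_def)
  then show R: "is_relation C X I"
    using I X hom_ends[OF p(1)] by (simp add: is_image_def is_relation_def)
  show iff: "h \<in> rel_hom C I S \<longleftrightarrow> related C S (h \<cdot> f) (h \<cdot> g)"
    if h: "h \<in> hom C X Y" and S: "is_relation C Y S" for h Y S
  proof -
    have "prod_arr C h h \<in> hom C (Cod C (pairing C f g)) (prod_obj C Y Y)"
      using prod_arr(1)[OF h h] hom_ends[OF p(1)] by simp
    then have "factors_through C (prod_arr C h h \<cdot> emb I) (emb S) \<longleftrightarrow>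
        factors_through C (prod_arr C h h \<cdot> pairing C f g) (emb S)"
      using S by (intro factors_through_image_iff[OF im]) (auto simp: is_relation_def)
    also have "\<dots> \<longleftrightarrow> related C S (h \<cdot> f) (h \<cdot> g)"
      using factors_through_pairing_iff[OF S comp_hom[OF f h] comp_hom[OF g h]]
      by (simp add: prod_arr_pairing[OF h h f g])
    finally show ?thesis
      using h I relation_base(1)[OF S] by (simp add: rel_hom_def)
  qed
  note i = ident_hom[OF X] and r = relation_hom[OF R]
  \<comment> \<open>Reading the identity on \<open>I\<close> through \<open>iff\<close> puts the
    original span into \<open>I\<close>.\<close>
  have "Ident C X \<in> rel_hom C I I"
    using rel_hom_iff[OF R R i] related_lft_rgt[OF R]
    by (simp add: comp_ident_left[OF r(2)] comp_ident_left[OF r(3)])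
  then show "related C I f g"
    using iff[OF i R] by (simp add: comp_ident_left[OF f] comp_ident_left[OF g])
qed

lemma functor_hom: "is_functor C C F \<Longrightarrow> f \<in> hom C X Y \<Longrightarrow> FArr F f \<in> hom C (FObj F X) (FObj F Y)"
  by (simp add: is_functor_def)

lemma functor_comp:
  "\<lbrakk>is_functor C C F; f \<in> hom C X Y; g \<in> hom C Y Z\<rbrakk> \<Longrightarrow> FArr F (g \<cdot> f) = FArr F g \<cdot> FArr F f"
  by (simp add: is_functor_def)

text \<open>\<open>R\<close> need not be monic here, which saves proving that \<open>rel_prod\<close> is.\<close>

lemma canonical_lift:
  assumes "base R = X" "FArr F (lft C R) \<in> hom C Z (FObj F X)" "FArr F (rgt C R) \<in> hom C Z (FObj F X)"
  shows "is_relation C (FObj F X) (canonical_lift C F R)"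
    and "\<And>h Y S. \<lbrakk>h \<in> hom C (FObj F X) Y; is_relation C Y S\<rbrakk> \<Longrightarrow>
      h \<in> rel_hom C (canonical_lift C F R) S \<longleftrightarrow>
      related C S (h \<cdot> FArr F (lft C R)) (h \<cdot> FArr F (rgt C R))"
    and "related C (canonical_lift C F R) (FArr F (lft C R)) (FArr F (rgt C R))"
  by (rule image_relation[OF assms(2,3)]; simp add: canonical_lift_def assms(1))+

text \<open>The definition takes an image twice, in the lift and along \<open>a\<close>. Both are
  removed by orthogonality: the outer one by inserting an identity for \<open>p\<close> in
  \<open>factors_through_image_iff\<close>, the inner one by treating \<open>a\<close> as a morphism
  out of the canonical lift. What is left is a condition on the projections of
  \<open>R\<close>.\<close>

lemma congruence_iff:
  assumes F: "is_functor C C F" and a: "a \<in> hom C (FObj F X) X"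
  shows "congruence C F X a R \<longleftrightarrow>
    is_relation C X R \<and> related C R (a \<cdot> FArr F (lft C R)) (a \<cdot> FArr F (rgt C R))"
proof (cases "is_relation C X R")
  case R: True
  note r = relation_hom[OF R] and b = relation_base[OF R]
  note L = canonical_lift[OF b(1) functor_hom[OF F r(2)] functor_hom[OF F r(3)]]
  let ?L = "canonical_lift C F R"
  let ?w = "prod_arr C a a \<cdot> emb ?L"
  have w: "?w \<in> hom C (Dom C (emb ?L)) (prod_obj C X X)"
    using comp_hom[OF relation_hom(1)[OF L(1)] prod_arr(1)[OF a a]] .
  have im: "is_image C ?w (image_arr C ?w)"
    using is_image_image_arr w by (simp add: hom_def)
  have m: "image_arr C ?w \<in> hom C (Dom C (image_arr C ?w)) (prod_obj C X X)"
    using im hom_ends[OF w] by (simp add: is_image_def mono_arr_def hom_def)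
  have "factors_through C (Ident C (prod_obj C X X) \<cdot> image_arr C ?w) (emb R) \<longleftrightarrow>
      factors_through C (Ident C (prod_obj C X X) \<cdot> ?w) (emb R)"
    using R hom_ends[OF w] ident_hom[OF prod_obj_Obj[OF b(2) b(2)]]
    by (intro factors_through_image_iff[OF im]) (auto simp: is_relation_def)
  then have "rel_le C (direct_image C a a ?L) R \<longleftrightarrow> factors_through C ?w (emb R)"
    using hom_ends[OF a] b(1)
    by (simp add: comp_ident_left[OF w] comp_ident_left[OF m] rel_le_def direct_image_def)
  also have "\<dots> \<longleftrightarrow> a \<in> rel_hom C ?L R"
    using a b(1) relation_base(1)[OF L(1)] by (simp add: rel_hom_def)
  finally show ?thesis
    using L(2)[OF a R] R by (simp add: congruence_def)
qed (simp add: congruence_def)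

section \<open>Inverse images and meets of relations\<close>

lemma mono_pullback:
  assumes pb: "is_pullback C f m p q" and m: "mono_arr C m" and f: "f \<in> hom C X Y" "Cod C m = Y"
  shows "mono_arr C p"
proof -
  have mh: "m \<in> hom C (Dom C m) Y"
    using m f(2) by (simp add: mono_arr_def hom_def)
  have p: "p \<in> hom C (Dom C p) X" and q: "q \<in> hom C (Dom C p) (Dom C m)" and eq: "f \<cdot> p = m \<cdot> q"
    using pb hom_ends[OF f(1)] by (auto simp: is_pullback_def)
  have "s = t" if s: "s \<in> hom C Z (Dom C p)" and t: "t \<in> hom C Z (Dom C p)" and st: "p \<cdot> s = p \<cdot> t"
    for Z s t
  proof -
    have "m \<cdot> (q \<cdot> s) = f \<cdot> (p \<cdot> s)" "m \<cdot> (q \<cdot> t) = f \<cdot> (p \<cdot> t)"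
      using comp_assoc[OF s q mh] comp_assoc[OF t q mh] comp_assoc[OF s p f(1)] comp_assoc[OF t p f(1)]
        eq by auto
    then have "m \<cdot> (q \<cdot> s) = m \<cdot> (q \<cdot> t)"
      using st by simp
    then have "q \<cdot> s = q \<cdot> t"
      using m comp_hom[OF s q] comp_hom[OF t q] unfolding mono_arr_def by blast
    moreover have "\<exists>!h. h \<in> hom C Z (Dom C p) \<and> p \<cdot> h = p \<cdot> s \<and> q \<cdot> h = q \<cdot> s"
      using pb comp_hom[OF s p] comp_hom[OF s q] hom_ends[OF f(1)]
        \<open>m \<cdot> (q \<cdot> s) = f \<cdot> (p \<cdot> s)\<close> unfolding is_pullback_def by metis
    ultimately show ?thesis
      using s t st by metis
  qed
  then show ?thesis
    using p by (auto simp: mono_arr_def hom_def)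
qed

text \<open>Membership of a span is the universal property of the pullback at the arrow
  \<open>pairing C s t\<close>, read back through \<open>factors_through_pairing_iff\<close>. This
  holds for whichever pullback has been chosen.\<close>

lemma inverse_image:
  assumes S: "is_relation C Y S" and f: "f \<in> hom C X Y" and g: "g \<in> hom C X Y"
  shows "is_relation C X (inverse_image C f g S)"
    and "\<And>Z s t. \<lbrakk>s \<in> hom C Z X; t \<in> hom C Z X\<rbrakk> \<Longrightarrow>
      related C (inverse_image C f g S) s t \<longleftrightarrow> related C S (f \<cdot> s) (g \<cdot> t)"
proof -
  note X = hom_Obj(1)[OF f] and Y = hom_Obj(2)[OF f] and e = relation_hom(1)[OF S]
  let ?w = "prod_arr C f g" and ?I = "inverse_image C f g S"
  note w = prod_arr(1)[OF f g]
  have "\<exists>p q. is_pullback C ?w (emb S) p q"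
    using pullback_exists[OF w e] .
  then have "\<exists>q. is_pullback C ?w (emb S) (pullback_along C ?w (emb S)) q"
    unfolding pullback_along_def by (rule someI_ex)
  then obtain q where q: "is_pullback C ?w (emb S) (emb ?I) q"
    by (auto simp: inverse_image_def)
  have "mono_arr C (emb ?I)"
    using mono_pullback[OF q _ w] S by (simp add: is_relation_def)
  then show I: "is_relation C X ?I"
    using q X hom_ends[OF w] hom_ends[OF f]
    by (auto simp: is_relation_def is_pullback_def hom_def inverse_image_def)
  show "related C ?I s t \<longleftrightarrow> related C S (f \<cdot> s) (g \<cdot> t)"
    if s: "s \<in> hom C Z X" and t: "t \<in> hom C Z X" for Z s t
  proof -
    note p = pairing(1)[OF s t]
    have wp: "Dom C (?w \<cdot> pairing C s t) = Z"
      using hom_ends[OF comp_hom[OF p w]] by simp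
    have qh: "q \<in> hom C (Dom C (emb ?I)) (Dom C (emb S))" and eq: "?w \<cdot> emb ?I = emb S \<cdot> q"
      using q by (auto simp: is_pullback_def)
    note i = relation_hom(1)[OF I]
    have "factors_through C (pairing C s t) (emb ?I) \<longleftrightarrow> factors_through C (?w \<cdot> pairing C s t) (emb S)"
      unfolding factors_through_def wp
    proof
      assume "\<exists>h\<in>hom C (Dom C (pairing C s t)) (Dom C (emb ?I)). emb ?I \<cdot> h = pairing C s t"
      then obtain h where h: "h \<in> hom C Z (Dom C (emb ?I))" "emb ?I \<cdot> h = pairing C s t"
        using hom_ends[OF p] by auto
      have "emb S \<cdot> (q \<cdot> h) = ?w \<cdot> pairing C s t"
        using comp_assoc[OF h(1) qh e] comp_assoc[OF h(1) i w] eq h(2) by simp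
      then show "\<exists>h\<in>hom C Z (Dom C (emb S)). emb S \<cdot> h = ?w \<cdot> pairing C s t"
        using comp_hom[OF h(1) qh] by blast
    next
      assume "\<exists>h\<in>hom C Z (Dom C (emb S)). emb S \<cdot> h = ?w \<cdot> pairing C s t"
      then obtain h where h: "h \<in> hom C Z (Dom C (emb S))" "?w \<cdot> pairing C s t = emb S \<cdot> h"
        by auto
      have "pairing C s t \<in> hom C Z (Dom C ?w)"
        using p hom_ends[OF w] by simp
      then have "\<exists>!k. k \<in> hom C Z (Dom C (emb ?I)) \<and> emb ?I \<cdot> k = pairing C s t \<and> q \<cdot> k = h"
        using q h unfolding is_pullback_def by blast
      then show "\<exists>h\<in>hom C (Dom C (pairing C s t)) (Dom C (emb ?I)). emb ?I \<cdot> h = pairing C s t"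
        using hom_ends[OF p] by auto
    qed
    then show ?thesis
      using factors_through_pairing_iff[OF I s t]
        factors_through_pairing_iff[OF S comp_hom[OF s f] comp_hom[OF t g]]
      by (simp add: prod_arr_pairing[OF f g s t])
  qed
qed

text \<open>The family \<open>A\<close> may be large. Well-poweredness gives a small set
  \<open>M\<close> of representatives of the subobjects of \<open>Y\<close>; those representing
  members of \<open>A\<close> form the small set \<open>K\<close>, which the same arrows factor
  through, and the intersection is the wide pullback of \<open>K\<close>.\<close>

lemma intersection_exists:
  assumes Y: "Y \<in> Obj C" and A: "A \<noteq> {}" "\<And>m. m \<in> A \<Longrightarrow> mono_arr C m \<and> Cod C m = Y"
  obtains n where "mono_arr C n" "Cod C n = Y"
    and "\<And>Z w. w \<in> hom C Z Y \<Longrightarrow>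
      factors_through C w n \<longleftrightarrow> (\<forall>m\<in>A. factors_through C w m)"
proof -
  from well_powered[unfolded well_powered_def, rule_format, OF Y]
  obtain M where M: "small TYPE('u) M" "\<And>m. m \<in> M \<Longrightarrow> mono_arr C m \<and> Cod C m = Y"
    "\<And>n. mono_arr C n \<and> Cod C n = Y \<Longrightarrow> \<exists>m\<in>M. factors_through C n m \<and> factors_through C m n"
    by (elim exE conjE) simp
  define K where "K = {m \<in> M. \<exists>n\<in>A. factors_through C n m \<and> factors_through C m n}"
  have "K \<lesssim> M"
    by (intro subset_imp_lepoll) (auto simp: K_def)
  then have K: "small TYPE('u) K"
    using M(1) unfolding small_def by (rule lesspoll_trans1)
  have mono: "mono_arr C m" and hom: "m \<in> hom C (Dom C m) Y" if "m \<in> K" for m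
    using M(2) that by (auto simp: K_def mono_arr_def hom_def)
  have trans: "factors_through C w m'" if wm: "factors_through C w m" and mm: "factors_through C m m'"
    and w: "w \<in> hom C Z Y" and m: "mono_arr C m" and m': "mono_arr C m'" "Cod C m' = Y" for w m m' Z
  proof -
    obtain h where h: "h \<in> hom C Z (Dom C m)" "m \<cdot> h = w"
      using wm hom_ends[OF w] by (auto simp: factors_through_def)
    obtain k where k: "k \<in> hom C (Dom C m) (Dom C m')" "m' \<cdot> k = m"
      using mm by (auto simp: factors_through_def)
    have "m' \<in> hom C (Dom C m') Y"
      using m' by (simp add: mono_arr_def hom_def)
    from comp_assoc[OF h(1) k(1) this] show ?thesis
      using h k comp_hom[OF h(1) k(1)] hom_ends[OF w] unfolding factors_through_def by auto
  qed
  have KA: "(\<forall>m\<in>K. factors_through C w m) \<longleftrightarrow> (\<forall>m\<in>A. factors_through C w m)"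
    if w: "w \<in> hom C Z Y" for w Z
  proof (intro iffI ballI)
    fix m assume *: "\<forall>m\<in>K. factors_through C w m" and m: "m \<in> A"
    obtain m' where m': "m' \<in> M" "factors_through C m m'" "factors_through C m' m"
      using M(3) A(2)[OF m] by blast
    then have "m' \<in> K"
      using m by (auto simp: K_def)
    then show "factors_through C w m"
      using trans[OF _ m'(3) w] * A(2)[OF m] mono by blast
  next
    fix m assume *: "\<forall>m\<in>A. factors_through C w m" and m: "m \<in> K"
    then obtain m' where m': "m' \<in> A" "factors_through C m' m"
      by (auto simp: K_def)
    then show "factors_through C w m"
      using trans[OF _ m'(2) w] * A(2)[OF m'(1)] mono[OF m] hom_ends[OF hom[OF m]] by blast
  qed
  obtain k where k: "k \<in> K"
    using A M(3) by (fastforce simp: K_def)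
  show thesis
  proof (rule wide_pullback[OF category_axioms infinite_universe complete K Y, of "\<lambda>m. m", OF hom])
    fix L q p
    assume q: "q \<in> hom C L Y" and p: "\<And>m. m \<in> K \<Longrightarrow> p m \<in> hom C L (Dom C m)"
      and mp: "\<And>m. m \<in> K \<Longrightarrow> m \<cdot> p m = q"
      and univ: "\<And>Z g h. \<lbrakk>g \<in> hom C Z Y; \<And>m. m \<in> K \<Longrightarrow> h m \<in> hom C Z (Dom C m) \<and> m \<cdot> h m = g\<rbrakk>
        \<Longrightarrow> \<exists>!x. x \<in> hom C Z L \<and> q \<cdot> x = g \<and> (\<forall>m\<in>K. p m \<cdot> x = h m)"
    have dom: "Dom C q = L" "Cod C q = Y"
      using hom_ends[OF q] by auto
    have pq: "m \<cdot> (p m \<cdot> s) = q \<cdot> s" if "m \<in> K" "s \<in> hom C Z L" for m s Z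
      using comp_assoc[OF that(2) p hom] that(1) mp by simp
    \<comment> \<open>The leg \<open>q\<close> is monic: arrows that it identifies are identified by
      each \<open>p m\<close>, because each \<open>m\<close> is monic, and so they agree by the
      uniqueness of mediating arrows.\<close>
    have "s = t" if s: "s \<in> hom C Z L" and t: "t \<in> hom C Z L" and st: "q \<cdot> s = q \<cdot> t" for Z s t
    proof -
      have "p m \<cdot> s = p m \<cdot> t" if m: "m \<in> K" for m
        using mono[OF m] comp_hom[OF s p[OF m]] comp_hom[OF t p[OF m]] pq[OF m s] pq[OF m t] st
        unfolding mono_arr_def by metis
      moreover have "\<exists>!x. x \<in> hom C Z L \<and> q \<cdot> x = q \<cdot> s \<and> (\<forall>m\<in>K. p m \<cdot> x = p m \<cdot> s)"
        using comp_hom[OF s p] pq[OF _ s] by (intro univ comp_hom[OF s q]) blast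
      ultimately show ?thesis
        using s t st by metis
    qed
    then have qm: "mono_arr C q"
      using q dom by (auto simp: mono_arr_def hom_def)
    have "factors_through C w q \<longleftrightarrow> (\<forall>m\<in>K. factors_through C w m)" if w: "w \<in> hom C Z Y" for w Z
    proof (intro iffI ballI)
      fix m assume *: "factors_through C w q" and m: "m \<in> K"
      have "factors_through C q m"
        using p[OF m] mp[OF m] dom by (auto simp: factors_through_def)
      then show "factors_through C w m"
        using trans[OF * _ w qm mono[OF m]] hom_ends[OF hom[OF m]] by blast
    next
      assume "\<forall>m\<in>K. factors_through C w m"
      then have "\<forall>m\<in>K. \<exists>h. h \<in> hom C Z (Dom C m) \<and> m \<cdot> h = w"
        using hom_ends[OF w] by (auto simp: factors_through_def)
      then obtain h where "\<And>m. m \<in> K \<Longrightarrow> h m \<in> hom C Z (Dom C m) \<and> m \<cdot> h m = w"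
        by metis
      from univ[OF w this] show "factors_through C w q"
        using dom hom_ends[OF w] unfolding factors_through_def by auto
    qed
    then show thesis
      using that[OF qm dom(2)] KA by simp
  qed
qed

text \<open>A meet is defined by comparison with relations, whereas a span need not be jointly
  monic. So the claim about spans is proved for the concrete intersection \<open>N\<close>. It
  passes to the chosen meet, which lies below every member of \<open>A\<close> and above
  \<open>N\<close>.\<close>

lemma rel_meet:
  assumes A: "A \<noteq> {}" "\<And>R. R \<in> A \<Longrightarrow> is_relation C X R"
  shows "is_relation C X (rel_meet C X A)"
    and "\<And>Z f g. \<lbrakk>f \<in> hom C Z X; g \<in> hom C Z X\<rbrakk> \<Longrightarrow>
      related C (rel_meet C X A) f g \<longleftrightarrow> (\<forall>R\<in>A. related C R f g)"
proof -
  have X: "X \<in> Obj C"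
    using A relation_base(2) by blast
  obtain n where n: "mono_arr C n" "Cod C n = prod_obj C X X"
    and fac: "\<And>Z w. w \<in> hom C Z (prod_obj C X X) \<Longrightarrow>
      factors_through C w n \<longleftrightarrow> (\<forall>m\<in>emb ` A. factors_through C w m)"
    by (rule intersection_exists[OF prod_obj_Obj[OF X X], of "emb ` A"])
      (use A in \<open>auto simp: is_relation_def\<close>)
  define N where "N = \<lparr>base = X, emb = n\<rparr>"
  have N: "is_relation C X N"
    using n X by (simp add: N_def is_relation_def)
  have le_N: "rel_le C R N \<longleftrightarrow> (\<forall>S\<in>A. rel_le C R S)" if "is_relation C X R" for R
    using fac[OF relation_hom(1)[OF that]] relation_base(1)[OF that]
      relation_base(1)[OF A(2)] \<open>A \<noteq> {}\<close>
    by (simp add: rel_le_def N_def)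
  have "rel_le C N N"
    using rel_le_iff[OF N N] related_lft_rgt[OF N] by simp
  then have "is_rel_meet C X A N"
    using N le_N by (simp add: is_rel_meet_def)
  then have M: "is_rel_meet C X A (rel_meet C X A)"
    unfolding rel_meet_def by (rule someI)
  then show R: "is_relation C X (rel_meet C X A)"
    by (simp add: is_rel_meet_def)
  fix Z f g assume f: "f \<in> hom C Z X" and g: "g \<in> hom C Z X"
  show "related C (rel_meet C X A) f g \<longleftrightarrow> (\<forall>R\<in>A. related C R f g)"
  proof (intro iffI ballI)
    fix S assume "related C (rel_meet C X A) f g" "S \<in> A"
    then show "related C S f g"
      using M A(2) related_mono[OF R _ _ _ f] by (simp add: is_rel_meet_def)
  next
    assume "\<forall>R\<in>A. related C R f g"
    then have "factors_through C (pairing C f g) n"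
      using fac[OF pairing(1)[OF f g]] factors_through_pairing_iff[OF A(2) f g] by auto
    then have "related C N f g"
      using factors_through_pairing_iff[OF N f g] by (simp add: N_def)
    moreover have "rel_le C N (rel_meet C X A)"
      using M N le_N \<open>rel_le C N N\<close> by (simp add: is_rel_meet_def)
    ultimately show "related C (rel_meet C X A) f g"
      using related_mono[OF N R _ _ f] by blast
  qed
qed

section \<open>Free algebras\<close>

lemma pointed_functor:
  assumes V: "V \<in> Obj C" and F: "is_functor C C F"
  shows "is_functor C C (pointed_functor C V F)"
proof -
  have FX: "FObj F X \<in> Obj C" if "X \<in> Obj C" for X
    using F that by (simp add: is_functor_def)
  note i = ident_hom[OF V]
  show ?thesis
    unfolding is_functor_def pointed_functor_def cat_functor.simps
  proof (intro conjI ballI allI)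
    fix X assume X: "X \<in> Obj C"
    show "coprod_obj C V (FObj F X) \<in> Obj C"
      using coprod_obj_Obj V FX[OF X] by simp
    show "coprod_arr C (Ident C V) (FArr F (Ident C X)) = Ident C (coprod_obj C V (FObj F X))"
      using coprod_arr_ident[OF V FX[OF X]] F X by (simp add: is_functor_def)
  next
    fix X Y f assume f: "f \<in> hom C X Y"
    show "coprod_arr C (Ident C V) (FArr F f)
        \<in> hom C (coprod_obj C V (FObj F X)) (coprod_obj C V (FObj F Y))"
      using coprod_arr(1)[OF i functor_hom[OF F f]] .
  next
    fix X Y Z f g assume f: "f \<in> hom C X Y" and g: "g \<in> hom C Y Z"
    show "coprod_arr C (Ident C V) (FArr F (g \<cdot> f)) =
        coprod_arr C (Ident C V) (FArr F g) \<cdot> coprod_arr C (Ident C V) (FArr F f)"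
      using coprod_arr_comp[OF i functor_hom[OF F g] i functor_hom[OF F f]] functor_comp[OF F f g]
      by (simp add: comp_ident_left[OF i])
  qed
qed

lemma algebra_hom_comp:
  assumes F: "is_functor C C F" and "is_algebra C F X x" "is_algebra C F Y y" "is_algebra C F Z z"
    and h: "h \<in> algebra_hom C F (X, x) (Y, y)" and k: "k \<in> algebra_hom C F (Y, y) (Z, z)"
  shows "k \<cdot> h \<in> algebra_hom C F (X, x) (Z, z)"
proof -
  have x: "x \<in> hom C (FObj F X) X" and y: "y \<in> hom C (FObj F Y) Y" and z: "z \<in> hom C (FObj F Z) Z"
    using assms(2-4) by (auto simp: is_algebra_def)
  have hh: "h \<in> hom C X Y" "h \<cdot> x = y \<cdot> FArr F h" and kh: "k \<in> hom C Y Z" "k \<cdot> y = z \<cdot> FArr F k"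
    using h k by (auto simp: algebra_hom_def)
  note Fh = functor_hom[OF F hh(1)] and Fk = functor_hom[OF F kh(1)]
  have "(k \<cdot> h) \<cdot> x = k \<cdot> (y \<cdot> FArr F h)"
    using comp_assoc[OF x hh(1) kh(1)] hh(2) by simp
  also have "\<dots> = z \<cdot> FArr F (k \<cdot> h)"
    using comp_assoc[OF Fh y kh(1)] comp_assoc[OF Fh Fk z] kh(2) functor_comp[OF F hh(1) kh(1)]
    by simp
  finally show ?thesis
    using comp_hom[OF hh(1) kh(1)] by (simp add: algebra_hom_def)
qed

context
  fixes F :: "('o, 'm, 'o, 'm) cat_functor"
  assumes F: "is_functor C C F" and free: "has_free_algebras C F"
begin

lemma free_algebra:
  assumes "X \<in> Obj C"
  shows "is_free_algebra C F X (FObj (free_monad C F) X) (snd (fst (free_algebra C F X)))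
    (free_unit C F X)"
proof -
  obtain T t e where "is_free_algebra C F X T t e"
    using free assms by (auto simp: has_free_algebras_def)
  then have "(\<lambda>((T, t), e). is_free_algebra C F X T t e) ((T, t), e)"
    by simp
  from someI[of "\<lambda>((T, t), e). is_free_algebra C F X T t e", OF this] show ?thesis
    by (simp add: free_algebra_def free_monad_def free_unit_def split_beta)
qed

lemma fst_free_algebra:
  "fst (free_algebra C F X) = (FObj (free_monad C F) X, snd (fst (free_algebra C F X)))"
  by (simp add: free_monad_def)

lemma free_ext_ex1:
  assumes "is_algebra C F A a" "f \<in> hom C X A"
  shows "\<exists>!h. h \<in> algebra_hom C F (fst (free_algebra C F X)) (A, a) \<and> h \<cdot> free_unit C F X = f"
  using free_algebra[OF hom_Obj(1)[OF assms(2)]] assms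
  by (subst fst_free_algebra) (simp add: is_free_algebra_def)

lemma free_ext:
  assumes "is_algebra C F A a" "f \<in> hom C X A"
  shows "free_ext C F X (A, a) f \<in> algebra_hom C F (fst (free_algebra C F X)) (A, a)"
    and "free_ext C F X (A, a) f \<in> hom C (FObj (free_monad C F) X) A"
    and "free_ext C F X (A, a) f \<cdot> free_unit C F X = f"
proof -
  show *: "free_ext C F X (A, a) f \<in> algebra_hom C F (fst (free_algebra C F X)) (A, a)"
    and "free_ext C F X (A, a) f \<cdot> free_unit C F X = f"
    using theI'[OF free_ext_ex1[OF assms]] unfolding free_ext_def by blast+
  show "free_ext C F X (A, a) f \<in> hom C (FObj (free_monad C F) X) A"
    using * by (simp add: algebra_hom_def free_monad_def)
qed

lemma free_ext_eqI:
  assumes "is_algebra C F A a" "f \<in> hom C X A"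
    and "h \<in> algebra_hom C F (fst (free_algebra C F X)) (A, a)" "h \<cdot> free_unit C F X = f"
  shows "free_ext C F X (A, a) f = h"
  using free_ext_ex1[OF assms(1,2)] free_ext(1,3)[OF assms(1,2)] assms(3,4) by blast

lemma free_algebra_algebra:
  assumes "X \<in> Obj C"
  shows "is_algebra C F (FObj (free_monad C F) X) (snd (fst (free_algebra C F X)))"
    and "free_unit C F X \<in> hom C X (FObj (free_monad C F) X)"
  using free_algebra[OF assms] by (simp_all add: is_free_algebra_def)

text \<open>Both sides are homomorphisms out of the free algebra that agree on generators, so they
  are equal by uniqueness of extensions. This is naturality in the target algebra;
  \<open>free_ext_free_monad\<close> is the counterpart in the generators.\<close>

lemma algebra_hom_free_ext:
  assumes A: "is_algebra C F A a" and B: "is_algebra C F B b" and f: "f \<in> hom C X A"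
    and h: "h \<in> algebra_hom C F (A, a) (B, b)"
  shows "h \<cdot> free_ext C F X (A, a) f = free_ext C F X (B, b) (h \<cdot> f)"
proof (rule free_ext_eqI[symmetric, OF B])
  have hh: "h \<in> hom C A B"
    using h by (simp add: algebra_hom_def)
  note X = hom_Obj(1)[OF f]
  show "h \<cdot> f \<in> hom C X B"
    using comp_hom[OF f hh] .
  show "h \<cdot> free_ext C F X (A, a) f \<in> algebra_hom C F (fst (free_algebra C F X)) (B, b)"
    using algebra_hom_comp[OF F free_algebra_algebra(1)[OF X] A B _ h] free_ext(1)[OF A f]
    by (metis fst_free_algebra)
  show "(h \<cdot> free_ext C F X (A, a) f) \<cdot> free_unit C F X = h \<cdot> f"
    using comp_assoc[OF free_algebra_algebra(2)[OF X] free_ext(2)[OF A f] hh] free_ext(3)[OF A f]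
    by simp
qed

lemma free_monad_hom:
  assumes g: "g \<in> hom C X Y"
  shows "FArr (free_monad C F) g \<in> hom C (FObj (free_monad C F) X) (FObj (free_monad C F) Y)"
    and "FArr (free_monad C F) g \<in>
      algebra_hom C F (fst (free_algebra C F X)) (fst (free_algebra C F Y))"
    and "FArr (free_monad C F) g \<cdot> free_unit C F X = free_unit C F Y \<cdot> g"
proof -
  have eq: "FArr (free_monad C F) g =
      free_ext C F X (fst (free_algebra C F Y)) (free_unit C F Y \<cdot> g)"
    using hom_ends[OF g] by (simp add: free_monad_def)
  note Y = hom_Obj(2)[OF g]
  note fa = free_algebra_algebra[OF Y]
  note e = free_ext[OF fa(1) comp_hom[OF g fa(2)], folded fst_free_algebra]
  show "FArr (free_monad C F) g \<in> hom C (FObj (free_monad C F) X) (FObj (free_monad C F) Y)"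
    "FArr (free_monad C F) g \<in>
      algebra_hom C F (fst (free_algebra C F X)) (fst (free_algebra C F Y))"
    "FArr (free_monad C F) g \<cdot> free_unit C F X = free_unit C F Y \<cdot> g"
    unfolding eq by (fact e)+
qed

lemma free_ext_free_monad:
  assumes A: "is_algebra C F A a" and f: "f \<in> hom C Y A" and g: "g \<in> hom C X Y"
  shows "free_ext C F Y (A, a) f \<cdot> FArr (free_monad C F) g = free_ext C F X (A, a) (f \<cdot> g)"
proof (rule free_ext_eqI[symmetric, OF A])
  note X = hom_Obj(1)[OF g] and Y = hom_Obj(2)[OF g]
  note e = free_ext[OF A f] and m = free_monad_hom[OF g]
  show "f \<cdot> g \<in> hom C X A"
    using comp_hom[OF g f] .
  show "free_ext C F Y (A, a) f \<cdot> FArr (free_monad C F) g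
      \<in> algebra_hom C F (fst (free_algebra C F X)) (A, a)"
    using algebra_hom_comp[OF F free_algebra_algebra(1)[OF X] free_algebra_algebra(1)[OF Y] A]
      e(1) m(2) by (metis fst_free_algebra)
  show "(free_ext C F Y (A, a) f \<cdot> FArr (free_monad C F) g) \<cdot> free_unit C F X = f \<cdot> g"
    using comp_assoc[OF free_algebra_algebra(2)[OF X] m(1) e(2)] m(3) e(3)
      comp_assoc[OF g free_algebra_algebra(2)[OF Y] e(2)] by simp
qed

text \<open>The congruence \<open>R\<close> carries an algebra structure that makes both projections
  homomorphisms, so evaluation of terms restricts to \<open>R\<close>.\<close>

lemma congruence_eval:
  assumes R: "congruence C F X a R" and a: "is_algebra C F X a"
  shows "algebra_eval C F X a \<cdot> FArr (free_monad C F) (codiagonal C X)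
    \<in> rel_hom C (canonical_lift C (free_monad C F) (rel_coprod C R R)) R"
proof -
  have ah: "a \<in> hom C (FObj F X) X" and X: "X \<in> Obj C"
    using a by (auto simp: is_algebra_def)
  have rel: "is_relation C X R" and "related C R (a \<cdot> FArr F (lft C R)) (a \<cdot> FArr F (rgt C R))"
    using R congruence_iff[OF F ah] by auto
  note r = relation_hom[OF rel] and b = relation_base(1)[OF rel]
  let ?D = "Dom C (emb R)" and ?T = "free_monad C F"
  obtain q where q: "q \<in> hom C (FObj F ?D) ?D"
    "lft C R \<cdot> q = a \<cdot> FArr F (lft C R)" "rgt C R \<cdot> q = a \<cdot> FArr F (rgt C R)"
    by (rule relatedE[OF \<open>related C R _ _\<close> comp_hom[OF functor_hom[OF F r(2)] ah]])
  have D: "is_algebra C F ?D q"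
    using q(1) hom_Obj(1)[OF r(1)] by (simp add: is_algebra_def)
  have alg: "lft C R \<in> algebra_hom C F (?D, q) (X, a)" "rgt C R \<in> algebra_hom C F (?D, q) (X, a)"
    using q r by (auto simp: algebra_hom_def)

  note i = ident_hom[OF X]
  define n where "n = codiagonal C X"
  note n = copairing(1)[OF i i, folded codiagonal_def n_def]
  let ?P = "rel_coprod C R R"
  let ?l = "coprod_arr C (lft C R) (lft C R)" and ?r = "coprod_arr C (rgt C R) (rgt C R)"
  have P: "base ?P = coprod_obj C X X" "emb ?P = image_arr C (pairing C ?l ?r)"
    by (simp_all add: rel_coprod_def b)
  note l' = coprod_arr(1)[OF r(2) r(2)] and r' = coprod_arr(1)[OF r(3) r(3)]
  note im = image_relation[OF l' r' P]
  \<comment> \<open>The fold map \<open>k\<close> on the domain of \<open>R\<close> shows that the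
    codiagonal of \<open>X\<close> is a morphism from the coproduct relation to \<open>R\<close>. As
    that relation is an image, its domain need not be a coproduct; the arrow \<open>m\<close> out of
    it comes from \<open>image_relation\<close> and replaces \<open>k\<close> from then on.\<close>
  define k where "k = codiagonal C ?D"
  note j = ident_hom[OF hom_Obj(1)[OF r(1)]]
  note k = copairing(1)[OF j j, folded codiagonal_def k_def]
  have "n \<cdot> ?l = lft C R \<cdot> k" "n \<cdot> ?r = rgt C R \<cdot> k"
    using copairing_coprod_arr[OF r(2) r(2) i i] copairing_coprod_arr[OF r(3) r(3) i i]
      copairing_comp[OF j j r(2)] copairing_comp[OF j j r(3)]
    by (simp_all add: n_def k_def codiagonal_def comp_ident_left[OF r(2)] comp_ident_left[OF r(3)]
        comp_ident_right[OF r(2)] comp_ident_right[OF r(3)])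
  then have "n \<in> rel_hom C ?P R"
    using im(2)[OF n rel] related_compI[OF rel k] by simp
  then have "related C R (n \<cdot> lft C ?P) (n \<cdot> rgt C ?P)"
    using rel_hom_iff[OF im(1) rel n] by simp
  note p = relation_hom[OF im(1)]
  obtain m where m: "m \<in> hom C (Dom C (emb ?P)) ?D" "lft C R \<cdot> m = n \<cdot> lft C ?P"
    "rgt C R \<cdot> m = n \<cdot> rgt C ?P"
    by (rule relatedE[OF \<open>related C R (n \<cdot> lft C ?P) _\<close> comp_hom[OF p(2) n]])

  let ?e = "algebra_eval C F X a"
  have e: "?e = free_ext C F X (X, a) (Ident C X)"
    by (simp add: algebra_eval_def)
  note ev = free_ext(2)[OF a i, folded e]
  note Tn = free_monad_hom(1)[OF n]
  have en: "?e \<cdot> FArr ?T n = free_ext C F (coprod_obj C X X) (X, a) n"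
    using free_ext_free_monad[OF a i n] by (simp add: e comp_ident_left[OF n])
  \<comment> \<open>Terms over the coproduct relation are evaluated inside \<open>R\<close> itself,
    in the algebra \<open>q\<close>. Followed by the projections, which are homomorphisms, this
    evaluates the left and the right components in \<open>X\<close>.\<close>
  let ?h = "free_ext C F (Dom C (emb ?P)) (?D, q) m"
  note h = free_ext(2)[OF D m(1)]
  have "(?e \<cdot> FArr ?T n) \<cdot> FArr ?T (lft C ?P) = lft C R \<cdot> ?h"
    "(?e \<cdot> FArr ?T n) \<cdot> FArr ?T (rgt C ?P) = rgt C R \<cdot> ?h"
    using free_ext_free_monad[OF a n p(2)] free_ext_free_monad[OF a n p(3)]
      algebra_hom_free_ext[OF D a m(1) alg(1)] algebra_hom_free_ext[OF D a m(1) alg(2)] m(2,3) en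
    by simp_all
  then have "related C R ((?e \<cdot> FArr ?T n) \<cdot> FArr ?T (lft C ?P))
      ((?e \<cdot> FArr ?T n) \<cdot> FArr ?T (rgt C ?P))"
    using related_compI[OF rel h] by simp
  then show ?thesis
    using canonical_lift(2)[OF P(1) free_monad_hom(1)[OF p(2)] free_monad_hom(1)[OF p(3)]
        comp_hom[OF Tn ev] rel]
    by (simp add: n_def)
qed

end

text \<open>Restricted to the summand \<open>V\<close>, the arrows
  \<open>a \<cdot> \<Sigma>l\<close> and \<open>a \<cdot> \<Sigma>r\<close> both become the point,
  as the functor acts by the identity there. This secures the side condition under which the law is
  assumed to lift.\<close>

lemma congruence_point:
  assumes V: "V \<in> Obj C" and F: "is_functor C C F"
    and a: "a \<in> hom C (FObj (pointed_functor C V F) X) X"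
    and R: "congruence C (pointed_functor C V F) X a R"
  shows "algebra_point C V F X a \<in> hom C V X"
    and "related C R (algebra_point C V F X a) (algebra_point C V F X a)"
proof -
  let ?S = "pointed_functor C V F"
  note S = pointed_functor[OF V F]
  have rel: "is_relation C X R" and q: "related C R (a \<cdot> FArr ?S (lft C R)) (a \<cdot> FArr ?S (rgt C R))"
    using R congruence_iff[OF S a] by auto
  note r = relation_hom[OF rel] and i = ident_hom[OF V]
  have FX: "FObj F X \<in> Obj C" "FObj F (Dom C (emb R)) \<in> Obj C"
    using F hom_Obj[OF r(2)] by (auto simp: is_functor_def)
  note inj = inj_hom(1)[OF V FX(1)] inj_hom(1)[OF V FX(2)]
  have ah: "a \<in> hom C (coprod_obj C V (FObj F X)) X"
    using a by (simp add: pointed_functor_def)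
  show "algebra_point C V F X a \<in> hom C V X"
    unfolding algebra_point_def using comp_hom[OF inj(1) ah] .
  have S_hom: "FArr ?S f \<in> hom C (coprod_obj C V (FObj F (Dom C (emb R)))) (coprod_obj C V (FObj F X))"
    if "f \<in> hom C (Dom C (emb R)) X" for f
    using functor_hom[OF S that] by (simp add: pointed_functor_def)
  have pt: "(a \<cdot> FArr ?S f) \<cdot> inj1 C V (FObj F (Dom C (emb R))) = algebra_point C V F X a"
    if f: "f \<in> hom C (Dom C (emb R)) X" for f
    using comp_assoc[OF inj(2) S_hom[OF f] ah] coprod_arr(2)[OF i functor_hom[OF F f]]
    by (simp add: algebra_point_def pointed_functor_def comp_ident_right[OF inj(1)])
  show "related C R (algebra_point C V F X a) (algebra_point C V F X a)"
    using related_comp[OF rel q comp_hom[OF S_hom[OF r(2)] ah] inj(2)] pt[OF r(2)] pt[OF r(3)]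
    by simp
qed

section \<open>Relation liftings\<close>

text \<open>Later only the covariant argument changes, when terms are replaced by their values, so
  the action is extracted with an identity in the contravariant place. An arrow between relations is
  a triple whose middle component is the arrow in the base category.\<close>

lemma relation_lifting:
  assumes "is_relation_lifting C B Bl" and Q: "is_relation C X Q"
    and P: "is_relation C Y P"
  shows "is_relation C (FObj B (X, Y)) (FObj Bl (Q, P))"
    and "\<And>g Z P'. \<lbrakk>is_relation C Z P'; g \<in> rel_hom C P P'\<rbrakk> \<Longrightarrow>
      FArr B (Ident C X, g) \<in> rel_hom C (FObj Bl (Q, P)) (FObj Bl (Q, P'))"
proof -
  let ?E = "prod_cat (op_cat (rel_cat C)) (rel_cat C)"
  have lift: "is_functor ?E (rel_cat C) Bl"
    and base: "\<And>R S. R \<in> Obj (rel_cat C) \<Longrightarrow> S \<in> Obj (rel_cat C) \<Longrightarrow>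
      base (FObj Bl (R, S)) = FObj B (base R, base S)"
    and arr: "\<And>\<phi> \<psi>. \<phi> \<in> Arr (rel_cat C) \<Longrightarrow> \<psi> \<in> Arr (rel_cat C) \<Longrightarrow>
      fst (snd (FArr Bl (\<phi>, \<psi>))) = FArr B (fst (snd \<phi>), fst (snd \<psi>))"
    using assms(1) by (auto simp: is_relation_lifting_def is_bifunctor_def)
  have obj: "R \<in> Obj (rel_cat C)" if "is_relation C W R" for R W
    using that relation_base(1)[OF that] by (simp add: rel_cat_def)
  have "FObj Bl (Q, P) \<in> Obj (rel_cat C)"
    using lift obj[OF Q] obj[OF P] by (simp add: is_functor_def prod_cat_def)
  then show "is_relation C (FObj B (X, Y)) (FObj Bl (Q, P))"
    using base[OF obj[OF Q] obj[OF P]] relation_base(1)[OF Q] relation_base(1)[OF P]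
    by (simp add: rel_cat_def)
  fix g Z P' assume P': "is_relation C Z P'" and g: "g \<in> rel_hom C P P'"
  let ?\<phi> = "(Q, Ident C X, Q)" and ?\<psi> = "(P, g, P')"
  note i = ident_hom[OF relation_base(2)[OF Q]]
  have "Ident C X \<in> rel_hom C Q Q"
    using rel_hom_iff[OF Q Q i] related_lft_rgt[OF Q]
    by (simp add: comp_ident_left[OF relation_hom(2)[OF Q]] comp_ident_left[OF relation_hom(3)[OF Q]])
  then have arrs: "?\<phi> \<in> Arr (rel_cat C)" "?\<psi> \<in> Arr (rel_cat C)"
    using Q P P' g relation_base(1)[OF Q] relation_base(1)[OF P] relation_base(1)[OF P']
    by (simp_all add: rel_cat_def)
  then have "(?\<phi>, ?\<psi>) \<in> hom ?E (Q, P) (Q, P')"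
    by (simp add: hom_def prod_cat_def) (simp add: rel_cat_def)
  then have "FArr Bl (?\<phi>, ?\<psi>) \<in> hom (rel_cat C) (FObj Bl (Q, P)) (FObj Bl (Q, P'))"
    using lift by (simp add: is_functor_def)
  then have "fst (snd (FArr Bl (?\<phi>, ?\<psi>))) \<in> rel_hom C (FObj Bl (Q, P)) (FObj Bl (Q, P'))"
    by (auto simp: hom_def rel_cat_def)
  then show "FArr B (Ident C X, g) \<in> rel_hom C (FObj Bl (Q, P)) (FObj Bl (Q, P'))"
    using arr[OF arrs] by simp
qed

lemma bifunctor_hom:
  assumes B: "is_bifunctor C B" and X: "X \<in> Obj C" and g: "g \<in> hom C Y Z"
  shows "FArr B (Ident C X, g) \<in> hom C (FObj B (X, Y)) (FObj B (X, Z))"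
proof -
  have "(Ident C X, g) \<in> hom (prod_cat (op_cat C) C) (X, Y) (X, Z)"
    using ident_hom[OF X] g by (simp add: hom_def prod_cat_def)
  then show ?thesis
    using B by (simp add: is_bifunctor_def is_functor_def)
qed

lemma bifunctor_comp:
  assumes B: "is_bifunctor C B" and X: "X \<in> Obj C" and g: "g \<in> hom C Y Z" and h: "h \<in> hom C Z W"
  shows "FArr B (Ident C X, h \<cdot> g) = FArr B (Ident C X, h) \<cdot> FArr B (Ident C X, g)"
proof -
  have "(Ident C X, g) \<in> hom (prod_cat (op_cat C) C) (X, Y) (X, Z)"
    "(Ident C X, h) \<in> hom (prod_cat (op_cat C) C) (X, Z) (X, W)"
    using ident_hom[OF X] g h by (simp_all add: hom_def prod_cat_def)
  then have "FArr B ((Ident C X, h) \<cdot>\<^bsub>prod_cat (op_cat C) C\<^esub> (Ident C X, g)) =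
      FArr B (Ident C X, h) \<cdot> FArr B (Ident C X, g)"
    using B unfolding is_bifunctor_def is_functor_def by blast
  then show ?thesis
    by (simp add: prod_cat_def comp_ident_left[OF ident_hom[OF X]])
qed

text \<open>\<open>congruence_iff\<close> speaks of the projections only. If \<open>w\<close> is the
  factorization of the pair through \<open>R\<close>, then functoriality shows that restricting that
  condition along \<open>FArr F w\<close> gives the claim.\<close>

lemma related_algebra:
  assumes F: "is_functor C C F" and a: "a \<in> hom C (FObj F X) X"
    and R: "congruence C F X a R" and f: "f \<in> hom C Z X" and fg: "related C R f g"
  shows "related C R (a \<cdot> FArr F f) (a \<cdot> FArr F g)"
proof -
  have rel: "is_relation C X R" and q: "related C R (a \<cdot> FArr F (lft C R)) (a \<cdot> FArr F (rgt C R))"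
    using R congruence_iff[OF F a] by auto
  note r = relation_hom[OF rel]
  obtain w where w: "w \<in> hom C Z (Dom C (emb R))" "lft C R \<cdot> w = f" "rgt C R \<cdot> w = g"
    using relatedE[OF fg f] .
  note Fw = functor_hom[OF F w(1)] and Fl = functor_hom[OF F r(2)] and Fr = functor_hom[OF F r(3)]
  have "(a \<cdot> FArr F (lft C R)) \<cdot> FArr F w = a \<cdot> FArr F f"
    "(a \<cdot> FArr F (rgt C R)) \<cdot> FArr F w = a \<cdot> FArr F g"
    using comp_assoc[OF Fw Fl a] comp_assoc[OF Fw Fr a]
      functor_comp[OF F w(1) r(2)] functor_comp[OF F w(1) r(3)] w by simp_all
  then show ?thesis
    using related_comp[OF rel q comp_hom[OF Fl a] Fw] by simp
qed

lemma congruence_meet: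
  assumes F: "is_functor C C F" and a: "a \<in> hom C (FObj F X) X"
    and A: "A \<noteq> {}" "\<And>R. R \<in> A \<Longrightarrow> congruence C F X a R"
  shows "congruence C F X a (rel_meet C X A)"
proof -
  have rel: "is_relation C X R" if "R \<in> A" for R
    using A(2)[OF that] by (simp add: congruence_def)
  let ?M = "rel_meet C X A"
  have M: "is_relation C X ?M"
    and M_iff: "\<And>Z f g. f \<in> hom C Z X \<Longrightarrow> g \<in> hom C Z X \<Longrightarrow>
      related C ?M f g \<longleftrightarrow> (\<forall>R\<in>A. related C R f g)"
    using rel_meet[OF A(1), of X] rel by auto
  note r = relation_hom[OF M]
  have "related C R (a \<cdot> FArr F (lft C ?M)) (a \<cdot> FArr F (rgt C ?M))" if R: "R \<in> A" for R
  proof -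
    have "related C R (lft C ?M) (rgt C ?M)"
      using M_iff[OF r(2,3)] related_lft_rgt[OF M] R by blast
    then show ?thesis
      using related_algebra[OF F a A(2)[OF R] r(2)] by simp
  qed
  then show ?thesis
    using congruence_iff[OF F a] M
      M_iff[OF comp_hom[OF functor_hom[OF F r(2)] a] comp_hom[OF functor_hom[OF F r(3)] a]] by simp
qed

section \<open>Step-indexed relations\<close>

text \<open>The coalgebra enters an induced step only through the pairing with the identity; the law
  and the evaluation of terms after it are the same for \<open>c\<close> and \<open>c'\<close>. So
  one chain of relation morphisms acts on the two components at once. The bialgebra laws come in
  only afterwards.\<close>

lemma induced_step_related:
  fixes V :: 'o and S' S :: "('o, 'm, 'o, 'm) cat_functor"
  defines "S \<equiv> pointed_functor C V S'"
  assumes V: "V \<in> Obj C" and S': "is_functor C C S'" and free: "has_free_algebras C S"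
    and B: "is_bifunctor C B" and Bl: "is_relation_lifting C B Bl"
    and law: "gsos_law C V S B \<rho>" and lifts: "gsos_law_lifts C V S Bl \<rho>"
    and a: "is_algebra C S X a" and R: "congruence C S X a R"
    and c: "c \<in> hom C X (FObj B (X, X))" and c': "c' \<in> hom C X (FObj B (X, X))"
    and f: "f \<in> hom C Z X" and g: "g \<in> hom C Z X" and fg: "related C R f g"
    and cfg: "related C (FObj Bl (R, R)) (c \<cdot> f) (c' \<cdot> g)"
  shows "related C (FObj Bl (R, R)) (induced_step C V S' B \<rho> X a c \<cdot> FArr S f)
      (induced_step C V S' B \<rho> X a c' \<cdot> FArr S g)"
    and "induced_step C V S' B \<rho> X a c' \<in> hom C (FObj S X) (FObj B (X, X))"
proof -
  have S: "is_functor C C S"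
    unfolding S_def using pointed_functor[OF V S'] .
  have ah: "a \<in> hom C (FObj S X) X" and X: "X \<in> Obj C"
    using a by (auto simp: is_algebra_def)
  have rel: "is_relation C X R"
    using R by (simp add: congruence_def)
  note r = relation_hom[OF rel] and b = relation_base(1)[OF rel]
  let ?Q = "FObj Bl (R, R)"
  note Q = relation_lifting(1)[OF Bl rel rel]
  note s = relation_hom[OF Q]
  define BX where "BX = FObj B (X, X)"
  have BX: "BX \<in> Obj C"
    using relation_base(2)[OF Q] by (simp add: BX_def)
  note i = ident_hom[OF X]

  let ?P = "rel_prod C R ?Q"
  note p = prod_arr(1)[OF r(2) s(2)] prod_arr(1)[OF r(3) s(3)]
  have P: "base ?P = prod_obj C X BX" "lft C ?P = prod_arr C (lft C R) (lft C ?Q)"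
    "rgt C ?P = prod_arr C (rgt C R) (rgt C ?Q)"
    using pairing(2,3)[OF p]
    by (simp_all add: rel_prod_def lft_def rgt_def BX_def b relation_base(1)[OF Q])
  obtain h where h: "h \<in> hom C Z (Dom C (emb R))" "lft C R \<cdot> h = f" "rgt C R \<cdot> h = g"
    using relatedE[OF fg f] .
  obtain k where k: "k \<in> hom C Z (Dom C (emb ?Q))" "lft C ?Q \<cdot> k = c \<cdot> f" "rgt C ?Q \<cdot> k = c' \<cdot> g"
    using relatedE[OF cfg comp_hom[OF f c]] .
  note hk = pairing(1)[OF h(1) k(1)]
  have lk: "lft C ?P \<cdot> pairing C h k = pairing C (Ident C X) c \<cdot> f"
    using prod_arr_pairing[OF r(2) s(2) h(1) k(1)] pairing_comp[OF i c f] h(2) k(2)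
    by (simp add: P comp_ident_left[OF f])
  have rk: "rgt C ?P \<cdot> pairing C h k = pairing C (Ident C X) c' \<cdot> g"
    using prod_arr_pairing[OF r(3) s(3) h(1) k(1)] pairing_comp[OF i c' g] h(3) k(3)
    by (simp add: P comp_ident_left[OF g])
  have ph: "lft C ?P \<in> hom C (prod_obj C (Dom C (emb R)) (Dom C (emb ?Q))) (prod_obj C X BX)"
    "rgt C ?P \<in> hom C (prod_obj C (Dom C (emb R)) (Dom C (emb ?Q))) (prod_obj C X BX)"
    using p by (simp_all add: P BX_def)
  note Sp = functor_hom[OF S ph(1)] functor_hom[OF S ph(2)]
  note L = canonical_lift[OF P(1) Sp]

  let ?T = "free_monad C S" and ?p = "algebra_point C V S' X a"
  let ?M = "canonical_lift C ?T (rel_coprod C R R)" and ?XX = "coprod_obj C X X"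
  note pt = congruence_point[OF V S' ah[unfolded S_def] R[unfolded S_def]]
  have \<rho>: "\<rho> ?p X \<in> hom C (FObj S (prod_obj C X BX)) (FObj B (X, FObj ?T ?XX))"
    using law X pt(1) unfolding gsos_law_def BX_def by blast
  have "\<rho> ?p X \<in> rel_hom C (canonical_lift C S ?P) (FObj Bl (R, ?M))"
    using lifts X pt rel factors_through_pairing_iff[OF rel pt(1) pt(1)]
    unfolding gsos_law_lifts_def by blast
  have M: "is_relation C (FObj ?T ?XX) ?M"
  proof -
    have U: "base (rel_coprod C R R) = ?XX"
      by (simp add: rel_coprod_def b)
    have "is_relation C ?XX (rel_coprod C R R)"
      by (rule image_relation(1)[OF coprod_arr(1)[OF r(2) r(2)] coprod_arr(1)[OF r(3) r(3)]])
        (simp_all add: rel_coprod_def b)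
    note u = relation_hom[OF this]
    show ?thesis
      using canonical_lift(1)[OF U free_monad_hom(1)[OF S free u(2)] free_monad_hom(1)[OF S free u(3)]] .
  qed
  note BM = relation_lifting(1)[OF Bl rel M]
  have \<rho>_rel: "related C (FObj Bl (R, ?M)) (\<rho> ?p X \<cdot> FArr S (lft C ?P)) (\<rho> ?p X \<cdot> FArr S (rgt C ?P))"
    using L(2)[OF \<rho> BM] \<open>\<rho> ?p X \<in> rel_hom C _ _\<close> by simp

  let ?e = "algebra_eval C S X a" and ?n = "FArr ?T (codiagonal C X)"
  have n: "?n \<in> hom C (FObj ?T ?XX) (FObj ?T X)"
    using free_monad_hom(1)[OF S free copairing(1)[OF i i]] by (simp add: codiagonal_def)
  have e: "?e \<in> hom C (FObj ?T X) X"
    using free_ext(2)[OF S free a i] by (simp add: algebra_eval_def)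
  \<comment> \<open>The two applications of \<open>B\<close> in the induced step are merged into
    one, because \<open>congruence_eval\<close> is about the composite of codiagonal and
    evaluation.\<close>
  let ?u = "FArr B (Ident C X, ?e \<cdot> ?n)"
  have u: "?u \<in> hom C (FObj B (X, FObj ?T ?XX)) BX"
    using bifunctor_hom[OF B X comp_hom[OF n e]] by (simp add: BX_def)
  have u_rel: "?u \<in> rel_hom C (FObj Bl (R, ?M)) ?Q"
    using relation_lifting(2)[OF Bl rel M rel congruence_eval[OF S free R a]] .
  note u1 = bifunctor_hom[OF B X n] and u2 = bifunctor_hom[OF B X e]

  have step: "induced_step C V S' B \<rho> X a d = ?u \<cdot> (\<rho> ?p X \<cdot> FArr S (pairing C (Ident C X) d))"
    and step_hom: "induced_step C V S' B \<rho> X a d \<in> hom C (FObj S X) BX"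
    if d: "d \<in> hom C X (FObj B (X, X))" for d
  proof -
    have Sd: "FArr S (pairing C (Ident C X) d) \<in> hom C (FObj S X) (FObj S (prod_obj C X BX))"
      using functor_hom[OF S pairing(1)[OF i d]] by (simp add: BX_def)
    note \<rho>d = comp_hom[OF Sd \<rho>]
    show "induced_step C V S' B \<rho> X a d = ?u \<cdot> (\<rho> ?p X \<cdot> FArr S (pairing C (Ident C X) d))"
      using comp_assoc[OF \<rho>d u1 u2] bifunctor_comp[OF B X n e]
      by (simp add: induced_step_def Let_def S_def)
    then show "induced_step C V S' B \<rho> X a d \<in> hom C (FObj S X) BX"
      using comp_hom[OF \<rho>d u] by simp
  qed
  show "induced_step C V S' B \<rho> X a c' \<in> hom C (FObj S X) (FObj B (X, X))"
    using step_hom[OF c'] by (simp add: BX_def)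
  note Shk = functor_hom[OF S hk]
  \<comment> \<open>The induced step at \<open>w\<close> becomes a restriction, along
    \<open>\<Sigma>\<close> of \<open>pairing C h k\<close>, of an arrow starting at a projection
    \<open>q\<close> of the product relation. Leaving \<open>d\<close>, \<open>w\<close> and
    \<open>q\<close> arbitrary covers both components.\<close>
  have step_comp: "induced_step C V S' B \<rho> X a d \<cdot> FArr S w =
      ?u \<cdot> ((\<rho> ?p X \<cdot> FArr S q) \<cdot> FArr S (pairing C h k))"
    if d: "d \<in> hom C X (FObj B (X, X))" and w: "w \<in> hom C Z X"
      and q: "q \<in> hom C (prod_obj C (Dom C (emb R)) (Dom C (emb ?Q))) (prod_obj C X BX)"
      and eq: "q \<cdot> pairing C h k = pairing C (Ident C X) d \<cdot> w" for d w q
  proof -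
    have pd: "pairing C (Ident C X) d \<in> hom C X (prod_obj C X BX)"
      using pairing(1)[OF i d] by (simp add: BX_def)
    note Sd = functor_hom[OF S pd] and Sw = functor_hom[OF S w] and Sq = functor_hom[OF S q]
    have "induced_step C V S' B \<rho> X a d \<cdot> FArr S w =
        ?u \<cdot> (\<rho> ?p X \<cdot> (FArr S (pairing C (Ident C X) d) \<cdot> FArr S w))"
      using comp_assoc[OF Sw comp_hom[OF Sd \<rho>] u] comp_assoc[OF Sw Sd \<rho>] step[OF d] by simp
    also have "FArr S (pairing C (Ident C X) d) \<cdot> FArr S w = FArr S q \<cdot> FArr S (pairing C h k)"
      using functor_comp[OF S w pd] functor_comp[OF S hk q] eq by simp
    finally show ?thesis
      using comp_assoc[OF Shk Sq \<rho>] by simp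
  qed
  have "related C (FObj Bl (R, ?M)) ((\<rho> ?p X \<cdot> FArr S (lft C ?P)) \<cdot> FArr S (pairing C h k))
      ((\<rho> ?p X \<cdot> FArr S (rgt C ?P)) \<cdot> FArr S (pairing C h k))"
    using related_comp[OF BM \<rho>_rel comp_hom[OF Sp(1) \<rho>] Shk] .
  then have "related C ?Q (?u \<cdot> ((\<rho> ?p X \<cdot> FArr S (lft C ?P)) \<cdot> FArr S (pairing C h k)))
      (?u \<cdot> ((\<rho> ?p X \<cdot> FArr S (rgt C ?P)) \<cdot> FArr S (pairing C h k)))"
    using related_if_lft_rgt[OF BM Q u[unfolded BX_def] u[unfolded BX_def] _ _
        comp_hom[OF Shk comp_hom[OF Sp(1) \<rho>]]] u_rel rel_hom_iff[OF BM Q u[unfolded BX_def]] by simp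
  then show "related C ?Q (induced_step C V S' B \<rho> X a c \<cdot> FArr S f)
      (induced_step C V S' B \<rho> X a c' \<cdot> FArr S g)"
    using step_comp[OF c f ph(1) lk] step_comp[OF c' g ph(2) rk] by simp
qed

text \<open>The meet with \<open>R\<close> in the successor step supplies half of the input: the law
  takes an argument together with its behaviour, so \<open>induced_step_related\<close> asks that
  the projections themselves be related by \<open>R\<close>, besides the lifting condition on
  \<open>c\<close> and \<open>c'\<close>.\<close>

lemma congruence_step:
  fixes V :: 'o and S' S :: "('o, 'm, 'o, 'm) cat_functor"
  defines "S \<equiv> pointed_functor C V S'"
  assumes V: "V \<in> Obj C" and S': "is_functor C C S'" and free: "has_free_algebras C S"
    and B: "is_bifunctor C B" and Bl: "is_relation_lifting C B Bl"
    and pre: "preordered_object C (FObj B (X, X)) (le X X)"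
    and up: "\<And>P Q. is_relation C X P \<Longrightarrow> is_relation C X Q \<Longrightarrow> up_closed C (le X X) (FObj Bl (P, Q))"
    and law: "gsos_law C V S B \<rho>" and lifts: "gsos_law_lifts C V S Bl \<rho>"
    and bialg: "bialgebra C V S' B \<rho> X a c" and lax: "lax_bialgebra C V S' B le \<rho> X a c'"
    and R: "congruence C S X a R"
  shows "congruence C S X a (rel_meet C X {R, inverse_image C c c' (FObj Bl (R, R))})"
proof -
  have S: "is_functor C C S"
    unfolding S_def using pointed_functor[OF V S'] .
  have a: "is_algebra C S X a" and c: "c \<in> hom C X (FObj B (X, X))"
    and c': "c' \<in> hom C X (FObj B (X, X))"
    and step_c: "induced_step C V S' B \<rho> X a c = c \<cdot> a"
    and step_c': "le X X (induced_step C V S' B \<rho> X a c') (c' \<cdot> a)"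
    using bialg lax by (auto simp: bialgebra_def lax_bialgebra_def S_def)
  then have ah: "a \<in> hom C (FObj S X) X"
    by (simp add: is_algebra_def)
  have rel: "is_relation C X R"
    using R by (simp add: congruence_def)
  let ?Q = "FObj Bl (R, R)"
  let ?I = "inverse_image C c c' ?Q"
  note Q = relation_lifting(1)[OF Bl rel rel]
  note I = inverse_image[OF Q c c']
  have AR: "is_relation C X P" if "P \<in> {R, ?I}" for P
    using that rel I(1) by blast
  let ?M = "rel_meet C X {R, ?I}"
  have M: "is_relation C X ?M"
    and M_iff: "\<And>Z f g. f \<in> hom C Z X \<Longrightarrow> g \<in> hom C Z X \<Longrightarrow>
      related C ?M f g \<longleftrightarrow> related C R f g \<and> related C ?Q (c \<cdot> f) (c' \<cdot> g)"
    using rel_meet[of "{R, ?I}" X] AR I(2) by auto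
  note m = relation_hom[OF M]
  let ?l = "lft C ?M" and ?r = "rgt C ?M"
  note Sl = functor_hom[OF S m(2)] and Sr = functor_hom[OF S m(3)]
  have lr: "related C R ?l ?r" "related C ?Q (c \<cdot> ?l) (c' \<cdot> ?r)"
    using M_iff[OF m(2,3)] related_lft_rgt[OF M] by auto
  note step = induced_step_related[OF V S' free[unfolded S_def] B Bl law[unfolded S_def]
      lifts[unfolded S_def] a[unfolded S_def] R[unfolded S_def] c c' m(2,3) lr, folded S_def]
  let ?s = "induced_step C V S' B \<rho> X a c'"
  note ca = comp_hom[OF ah c] and ca' = comp_hom[OF ah c']
  have "related C ?Q (c \<cdot> (a \<cdot> FArr S ?l)) (?s \<cdot> FArr S ?r)"
    using step(1) step_c comp_assoc[OF Sl ah c] by simp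
  then obtain h where h: "h \<in> hom C (FObj S (Dom C (emb ?M))) (Dom C (emb ?Q))"
    "lft C ?Q \<cdot> h = c \<cdot> (a \<cdot> FArr S ?l)" "rgt C ?Q \<cdot> h = ?s \<cdot> FArr S ?r"
    by (rule relatedE[OF _ comp_hom[OF comp_hom[OF Sl ah] c]])
  \<comment> \<open>The lax law compares arrows out of \<open>FObj S X\<close>; the preorder is
    stable under precomposition, here with \<open>FArr S ?r\<close>, which moves the comparison to
    the stage where up-closure is applied.\<close>
  have "le X X (?s \<cdot> FArr S ?r) (c' \<cdot> (a \<cdot> FArr S ?r))"
    using pre step(2) ca' Sr step_c' comp_assoc[OF Sr ah c'] unfolding preordered_object_def by metis
  then have "\<exists>h'\<in>hom C (FObj S (Dom C (emb ?M))) (Dom C (emb ?Q)).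
      lft C ?Q \<cdot> h' = c \<cdot> (a \<cdot> FArr S ?l) \<and> rgt C ?Q \<cdot> h' = c' \<cdot> (a \<cdot> FArr S ?r)"
    using up[OF rel rel] h comp_hom[OF comp_hom[OF Sl ah] c] comp_hom[OF comp_hom[OF Sr ah] c']
      relation_base(1)[OF Q] unfolding up_closed_def by metis
  then have "related C ?Q (c \<cdot> (a \<cdot> FArr S ?l)) (c' \<cdot> (a \<cdot> FArr S ?r))"
    using hom_ends[OF comp_hom[OF comp_hom[OF Sl ah] c]] by (simp add: related_def)
  moreover have "related C R (a \<cdot> FArr S ?l) (a \<cdot> FArr S ?r)"
    using related_algebra[OF S ah R m(2) lr(1)] .
  ultimately have "related C ?M (a \<cdot> FArr S ?l) (a \<cdot> FArr S ?r)"
    using M_iff[OF comp_hom[OF Sl ah] comp_hom[OF Sr ah]] by simp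
  then show ?thesis
    using congruence_iff[OF S ah] M by simp
qed

end

theorem theorem4p29:
  fixes C :: "('o, 'm) cat"
    and V X :: 'o
    and S' S :: "('o, 'm, 'o, 'm) cat_functor"
    and B :: "('o, 'm) bifunctor"
    and Bl :: "('o, 'm) rel_bifunctor"
    and le :: "'o \<Rightarrow> 'o \<Rightarrow> 'm \<Rightarrow> 'm \<Rightarrow> bool"
    and \<rho> :: "'m \<Rightarrow> 'o \<Rightarrow> 'm"
    and a c c' :: 'm
    and R :: "('o, 'm) relation"
    and \<alpha> :: "'i::wellorder"
  assumes "infinite (UNIV :: 'u set)"
    and "base_category TYPE('u) C"
    and "V \<in> Obj C"
    and "is_functor C C S'"
    and "S = pointed_functor C V S'"
    and "preserves_strong_epis C S"
    and "has_free_algebras C S"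
    and "is_bifunctor C B"
    and "is_relation_lifting C B Bl"
    and "\<And>Y Z. Y \<in> Obj C \<Longrightarrow> Z \<in> Obj C \<Longrightarrow> preordered_object C (FObj B (Y, Z)) (le Y Z)"
    and "\<And>Y Z P Q. is_relation C Y P \<Longrightarrow> is_relation C Z Q \<Longrightarrow>
           up_closed C (le Y Z) (FObj Bl (P, Q))"
    and "gsos_law C V S B \<rho>"
    and "gsos_law_lifts C V S Bl \<rho>"
    and "bialgebra C V S' B \<rho> X a c"
    and "lax_bialgebra C V S' B le \<rho> X a c'"
    and "congruence C S X a R"
  shows "congruence C S X a (step_indexed C Bl c c' R \<alpha>)"
proof -
  interpret category C
    using assms(2) by (simp add: base_category_def)
  interpret relation_category C "TYPE('u)"
    by unfold_locales (use assms(1,2) in \<open>auto simp: base_category_def\<close>)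
  have S: "is_functor C C S"
    using pointed_functor assms(3-5) by simp
  have a: "a \<in> hom C (FObj S X) X" and X: "X \<in> Obj C"
    using assms(5,14) by (auto simp: bialgebra_def is_algebra_def)
  have base: "base R = X"
    using assms(16) by (simp add: congruence_def is_relation_def)
  show ?thesis
  proof (induction \<alpha> rule: less_induct)
    case (less \<alpha>)
    \<comment> \<open>These are the branches of \<open>transfinite_iterate\<close>, told apart by
      the predecessors of \<alpha>: none, a greatest one, or some but no greatest one.\<close>
    consider "\<And>\<beta>. \<not> \<beta> < \<alpha>" | \<beta> where "\<beta> < \<alpha>" "\<And>\<gamma>. \<gamma> < \<alpha> \<Longrightarrow> \<gamma> \<le> \<beta>"
      | \<beta> where "\<beta> < \<alpha>" "\<And>\<beta>. \<beta> < \<alpha> \<Longrightarrow> \<exists>\<gamma><\<alpha>. \<beta> < \<gamma>"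
      by (meson not_le)
    then show ?case
    proof cases
      case 1
      then show ?thesis
        using assms(16) by (simp add: step_indexed_zero)
    next
      case 2
      have "congruence C S X a (rel_meet C X {step_indexed C Bl c c' R \<beta>, inverse_image C c c'
          (FObj Bl (step_indexed C Bl c c' R \<beta>, step_indexed C Bl c c' R \<beta>))})"
        unfolding assms(5)
        by (rule congruence_step[where V = V and S' = S' and B = B and le = le and \<rho> = \<rho>])
          (use assms X less[OF 2(1)] in simp_all)
      then show ?thesis
        by (simp add: step_indexed_succ[OF 2] base)
    next
      case 3
      \<comment> \<open>A limit has predecessors, so the family is nonempty as
        \<open>congruence_meet\<close> demands, and the induction hypothesis covers all its
        members.\<close>
      then show ?thesis
        using less by (simp only: step_indexed_limit[OF 3] base) (rule congruence_meet[OF S a], auto)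
    qed
  qed
qed

end
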